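(* Let $\mathcal L(\lambda)=\begin{bmatrix}M(\lambda)&K_2(\lambda)^T\\ K_1(\lambda)&0\end{bmatrix}$ be a strong block minimal bases degree-$\ell$ matrix polynomial, let $N_1(\lambda)$ be a minimal basis dual to $K_1(\lambda)$, let $N_2(\lambda)$ be a minimal basis dual to $K_2(\lambda)$, and let $Q(\lambda):=N_2(\lambda)M(\lambda)N_1(\lambda)^T$. Then: (a) If $0\le\epsilon_1\le\epsilon_2\le\cdots\le\epsilon_p$ are the right minimal indices of $Q(\lambda)$, then $$\epsilon_1+\deg(N_1(\lambda))\le\epsilon_2+\deg(N_1(\lambda))\le\cdots\le\epsilon_p+\deg(N_1(\lambda))$$ are the right minimal indices of $\mathcal L(\lambda)$. (b) If $0\le\eta_1\le\eta_2\le\cdots\le\eta_q$ are the left minimal indices of $Q(\lambda)$, then $$\eta_1+\deg(N_2(\lambda))\le\eta_2+\deg(N_2(\lambda))\le\cdots\le\eta_q+\deg(N_2(\lambda))$$ are the left minimal indices of $\mathcal L(\lambda)$.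
   Context: $\mathbb F$ is an arbitrary field; all matrix polynomials have coefficients in $\mathbb F$. A matrix polynomial has grade $g$ if it can be written $\sum_{i=0}^gP_i\lambda^i$ (coefficients possibly zero); its degree is the largest $i$ with nonzero coefficient. A minimal basis of a subspace of $\mathbb F(\lambda)^q$ is a basis of vector polynomials whose sum of degrees is least among all bases consisting of vector polynomials; the ordered list of degrees of its vectors is independent of the choice, and these degrees are the minimal indices of the subspace. A $p\times q$ matrix polynomial ($p<q$) is called a minimal basis if its rows form a minimal basis of the rational subspace they span. The row degrees are the degrees of the rows. $K(\lambda)\in\mathbb F[\lambda]^{p_1\times q}$ and $N(\lambda)\in\mathbb F[\lambda]^{p_2\times q}$ are dual minimal bases (each is a minimal basis dual to the other) if $p_1+p_2=q$, $K(\lambda)N(\lambda)^T=0$, and both are minimal bases. For $P(\lambda)\in\mathbb F[\lambda]^{m\times n}$, $\mathcal N_r(P)=\{x(\lambda)\in\mathbb F(\lambda)^{n\times1}:P(\lambda)x(\lambda)=0\}$ and $\mathcal N_\ell(P)=\{y(\lambda)^T\in\mathbb F(\lambda)^{1\times m}:y(\lambda)^TP(\lambda)=0\}$; the right (left) minimal indices of $P(\lambda)$ are those of $\mathcal N_r(P)$ ($\mathcal N_\ell(P)$). Strong block minimal bases degree-$\ell$ matrix polynomial ($\ell>0$): $\mathcal L(\lambda)=\begin{bmatrix}M(\lambda)&K_2(\lambda)^T\\ K_1(\lambda)&0\end{bmatrix}$ with $M(\lambda)$ of size $(m+m_2)\times(n+m_1)$ and grade $\ell$, $K_1(\lambda)\in\mathbb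 F[\lambda]^{m_1\times(n+m_1)}$ and $K_2(\lambda)\in\mathbb F[\lambda]^{m_2\times(m+m_2)}$ minimal bases with all row degrees equal to $\ell$, such that the row degrees of a minimal basis dual to $K_1(\lambda)$ are all equal, and the row degrees of a minimal basis dual to $K_2(\lambda)$ are all equal. Thus $N_1(\lambda)$ is $n\times(n+m_1)$, $N_2(\lambda)$ is $m\times(m+m_2)$, $Q(\lambda)$ is $m\times n$. Degenerate cases where exactly one of $K_1,K_2$ is absent ($m_1=0$ or $m_2=0$) are allowed; then $N_1=I_n$ or $N_2=I_m$ respectively. *)

theory Defs
  imports
    "HOL-Computational_Algebra.Polynomial_Factorial"
    "Jordan_Normal_Form.Matrix_Kernel"
begin

text \<open>
  Matrix polynomials over a field are of type \<^typ>\<open>'a::field poly mat\<close>; the field of rational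
  functions is \<^typ>\<open>'a::field poly fract\<close>. A vector \<^typ>\<open>'b vec\<close> is neither a row nor a column.
  All matrix sizes may be 0.
\<close>

abbreviation rat_vec :: "'a::field poly vec \<Rightarrow> 'a poly fract vec" where
  "rat_vec \<equiv> map_vec to_fract"

abbreviation rat_mat :: "'a::field poly mat \<Rightarrow> 'a poly fract mat" where
  "rat_mat \<equiv> map_mat to_fract"

definition has_grade :: "'a::field poly mat \<Rightarrow> nat \<Rightarrow> bool" where
  "has_grade A g \<longleftrightarrow>
    (\<exists>P :: nat \<Rightarrow> 'a mat. (\<forall>i\<le>g. P i \<in> carrier_mat (dim_row A) (dim_col A)) \<and>
      A = mat (dim_row A) (dim_col A) (\<lambda>(r, c). \<Sum>i\<le>g. monom (P i $$ (r, c)) i))"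

text \<open>The zero matrix polynomial and the zero vector polynomial get degree 0.\<close>

definition mat_degree :: "'a::field poly mat \<Rightarrow> nat" where
  "mat_degree A =
    Max (insert 0 {i. map_mat (\<lambda>p. coeff p i) A \<noteq> 0\<^sub>m (dim_row A) (dim_col A)})"

definition vec_degree :: "'a::field poly vec \<Rightarrow> nat" where
  "vec_degree v = Max (insert 0 {i. map_vec (\<lambda>p. coeff p i) v \<noteq> 0\<^sub>v (dim_vec v)})"

definition row_degrees :: "'a::field poly mat \<Rightarrow> nat list" where
  "row_degrees A = map vec_degree (rows A)"

text \<open>\<open>W\<close> is a subspace of the space of rational vectors of length \<open>q\<close>.\<close>

definition polynomial_basis ::
  "nat \<Rightarrow> 'a::field poly fract vec set \<Rightarrow> 'a poly vec list \<Rightarrow> bool" where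
  "polynomial_basis q W B \<longleftrightarrow>
    set B \<subseteq> carrier_vec q \<and> distinct B \<and>
    vectorspace.basis class_ring (module_vec TYPE('a poly fract) q\<lparr>carrier := W\<rparr>)
      (rat_vec ` set B)"

definition minimal_basis ::
  "nat \<Rightarrow> 'a::field poly fract vec set \<Rightarrow> 'a poly vec list \<Rightarrow> bool" where
  "minimal_basis q W B \<longleftrightarrow>
    polynomial_basis q W B \<and>
    (\<forall>C. polynomial_basis q W C \<longrightarrow>
      sum_list (map vec_degree B) \<le> sum_list (map vec_degree C))"

text \<open>
  The sorted degree list does not depend on the minimal basis, so \<open>minimal_indices q W\<close> holds of
  exactly one list.
\<close>

definition minimal_indices :: "nat \<Rightarrow> 'a::field poly fract vec set \<Rightarrow> nat list \<Rightarrow> bool" where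
  "minimal_indices q W ds \<longleftrightarrow> (\<exists>B. minimal_basis q W B \<and> ds = sort (map vec_degree B))"

definition minimal_basis_mat :: "'a::field poly mat \<Rightarrow> bool" where
  "minimal_basis_mat K \<longleftrightarrow>
    dim_row K < dim_col K \<and>
    minimal_basis (dim_col K)
      (vec_space.row_space (dim_col K) (rat_mat K)) (rows K)"

definition dual_minimal_bases :: "'a::field poly mat \<Rightarrow> 'a poly mat \<Rightarrow> bool" where
  "dual_minimal_bases K N \<longleftrightarrow>
    dim_col N = dim_col K \<and> dim_row K + dim_row N = dim_col K \<and>
    K * N\<^sup>T = 0\<^sub>m (dim_row K) (dim_row N) \<and>
    minimal_basis_mat K \<and> minimal_basis_mat N"

text \<open>If \<open>K\<close> has no rows, its dual is by convention the identity matrix.\<close>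

definition is_dual_of :: "'a::field poly mat \<Rightarrow> 'a poly mat \<Rightarrow> bool" where
  "is_dual_of N K \<longleftrightarrow>
    (if dim_row K = 0 then N = 1\<^sub>m (dim_col K) else dual_minimal_bases K N)"

definition left_null_space :: "'a::field poly mat \<Rightarrow> 'a poly fract vec set" where
  "left_null_space P =
    {y \<in> carrier_vec (dim_row P). mat_of_row y * rat_mat P = 0\<^sub>m 1 (dim_col P)}"

definition right_minimal_indices :: "'a::field poly mat \<Rightarrow> nat list \<Rightarrow> bool" where
  "right_minimal_indices P = minimal_indices (dim_col P) (mat_kernel (rat_mat P))"

definition left_minimal_indices :: "'a::field poly mat \<Rightarrow> nat list \<Rightarrow> bool" where
  "left_minimal_indices P = minimal_indices (dim_row P) (left_null_space P)"

text \<open>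
  \<open>m1 = 0\<close> and \<open>m2 = 0\<close> express that \<open>K1\<close> and \<open>K2\<close>, respectively, are absent; at most one may be.
  The condition on the row degrees of a dual minimal basis does not depend on the choice of the
  dual.
\<close>

definition strong_block_minimal_bases ::
  "nat \<Rightarrow> nat \<Rightarrow> nat \<Rightarrow> nat \<Rightarrow> nat \<Rightarrow>
    'a::field poly mat \<Rightarrow> 'a poly mat \<Rightarrow> 'a poly mat \<Rightarrow> bool" where
  "strong_block_minimal_bases l m n m1 m2 M K1 K2 \<longleftrightarrow>
    l > 0 \<and> (m1 > 0 \<or> m2 > 0) \<and>
    M \<in> carrier_mat (m + m2) (n + m1) \<and> has_grade M l \<and>
    K1 \<in> carrier_mat m1 (n + m1) \<and> minimal_basis_mat K1 \<and>
    (\<forall>d \<in> set (row_degrees K1). d = l) \<and>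
    (\<exists>N d. is_dual_of N K1 \<and> (\<forall>e \<in> set (row_degrees N). e = d)) \<and>
    K2 \<in> carrier_mat m2 (m + m2) \<and> minimal_basis_mat K2 \<and>
    (\<forall>d \<in> set (row_degrees K2). d = l) \<and>
    (\<exists>N d. is_dual_of N K2 \<and> (\<forall>e \<in> set (row_degrees N). e = d))"

definition block_matrix ::
  "'a::field poly mat \<Rightarrow> 'a poly mat \<Rightarrow> 'a poly mat \<Rightarrow> 'a poly mat" where
  "block_matrix M K1 K2 = four_block_mat M K2\<^sup>T K1 (0\<^sub>m (dim_row K1) (dim_row K2))"

end

theory Submission
  imports Defs "Jordan_Normal_Form.DL_Rank" "Subresultants.More_Homomorphisms"
begin

text \<open>
  Write \<open>d\<close> for the degree of \<open>N1\<close>. A vector \<open>(x, y)\<close> lies in the null space of \<open>L\<close> iff \<open>K1 x = 0\<close>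
  and \<open>K2\<^sup>T y = - M x\<close>. By duality and a dimension count (\<open>mat_kernel_eq_range_transpose\<close>) the kernel of
  \<open>K1\<close> is the range of \<open>N1\<^sup>T\<close>, and the kernel of \<open>N2\<close> is the range of \<open>K2\<^sup>T\<close>. So \<open>x = N1\<^sup>T z\<close> for a
  unique \<open>z\<close>, and a \<open>y\<close> with \<open>K2\<^sup>T y = - M x\<close> exists iff \<open>N2 M x = Q z = 0\<close>; it is then unique. Hence
  \<open>z \<mapsto> (N1\<^sup>T z, y)\<close> is a linear isomorphism from the right null space of \<open>Q\<close> to that of \<open>L\<close>.

  This isomorphism maps the nonzero polynomial vectors of one null space onto those of the other and
  raises their degrees by exactly \<open>d\<close>. Therefore it maps polynomial bases to polynomial bases, adding
  the same amount to every degree sum, so that it preserves minimality and adds \<open>d\<close> to each minimal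
  index (\<open>minimal_indices_transfer\<close>).

  The claim on polynomial vectors rests on two properties of a matrix \<open>C\<close> whose columns form a
  minimal basis with all degrees equal to \<open>d\<close> (\<open>shifts_degree\<close>): the degree of \<open>C w\<close> is \<open>d\<close> plus the
  degree of \<open>w\<close> for polynomial \<open>w \<noteq> 0\<close>, and \<open>C z\<close> is a polynomial vector only if \<open>z\<close> is one. If
  either failed, a vector of the basis could be exchanged for one of smaller degree
  (\<open>minimal_basis_exchange\<close>). They apply to \<open>K2\<^sup>T\<close>, whose columns have degree \<open>l\<close> by assumption, and to
  \<open>N1\<^sup>T\<close>: some minimal basis dual to \<open>K1\<close> has equal degrees, and then so has every other one
  (\<open>uniform_degrees_of_minimal_basis\<close>); if \<open>K1\<close> has no rows, then \<open>N1\<close> is the identity matrix, for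
  which both properties are clear with \<open>d = 0\<close>. If \<open>z\<close> is polynomial, then so are \<open>x = N1\<^sup>T z\<close>, the vector
  \<open>M x\<close> and, by the second property, \<open>y\<close>. If \<open>y \<noteq> 0\<close>, then \<open>l + deg y = deg (M x) \<le> l + deg x\<close>,
  because \<open>M\<close> has grade \<open>l\<close>. So the degree of \<open>(x, y)\<close> is that of \<open>x\<close>, which is \<open>d + deg z\<close>.

  Left null spaces are right null spaces of the transposes, and transposition turns the block matrix
  of \<open>M, K1, K2\<close> into that of \<open>M\<^sup>T, K2, K1\<close>, so the second half follows from the first.
\<close>

section \<open>Bases as matrices\<close>

lemma inj_on_mult_mat_vec_iff:
  fixes C :: "'b::field mat"
  assumes C: "C \<in> carrier_mat n k"
  shows "inj_on ((*\<^sub>v) C) (carrier_vec k) \<longleftrightarrow>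
    (\<forall>z \<in> carrier_vec k. C *\<^sub>v z = 0\<^sub>v n \<longrightarrow> z = 0\<^sub>v k)"
proof
  assume inj: "inj_on ((*\<^sub>v) C) (carrier_vec k)"
  have "C *\<^sub>v 0\<^sub>v k = 0\<^sub>v n" using C by auto
  with inj show "\<forall>z \<in> carrier_vec k. C *\<^sub>v z = 0\<^sub>v n \<longrightarrow> z = 0\<^sub>v k"
    by (metis inj_onD zero_carrier_vec)
next
  assume *: "\<forall>z \<in> carrier_vec k. C *\<^sub>v z = 0\<^sub>v n \<longrightarrow> z = 0\<^sub>v k"
  show "inj_on ((*\<^sub>v) C) (carrier_vec k)"
  proof (rule inj_onI)
    fix x y assume xy: "x \<in> carrier_vec k" "y \<in> carrier_vec k" "C *\<^sub>v x = C *\<^sub>v y"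
    then have "C *\<^sub>v (x - y) = 0\<^sub>v n"
      using C by (simp add: mult_minus_distrib_mat_vec)
    with * xy have "x - y = 0\<^sub>v k" by auto
    show "x = y"
    proof (rule eq_vecI)
      fix i assume i: "i < dim_vec y"
      have "(x - y) $ i = 0" unfolding \<open>x - y = 0\<^sub>v k\<close> using i xy by auto
      then show "x $ i = y $ i" using i by auto
    qed (use xy in auto)
  qed
qed

text \<open>
  A list of vectors is a basis iff taking linear combinations is a bijection from the coordinate
  space. In this form bases can be handled by matrix products, without reference to sums over sets
  of vectors.
\<close>

lemma (in vec_space) basis_iff_bij_betw:
  assumes W: "submodule class_ring W V" and bs: "set bs \<subseteq> carrier_vec n"
  shows "(distinct bs \<and> vectorspace.basis class_ring (V\<lparr>carrier := W\<rparr>) (set bs)) \<longleftrightarrow>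
    bij_betw ((*\<^sub>v) (mat_of_cols n bs)) (carrier_vec (length bs)) W"
proof -
  let ?C = "mat_of_cols n bs" let ?k = "length bs"
  have C: "?C \<in> carrier_mat n ?k" by simp
  have cols: "cols ?C = bs" using bs by (simp add: cols_mat_of_cols)
  have span: "span (set bs) = (*\<^sub>v) ?C ` carrier_vec ?k"
    using col_space_eq[OF C] mult_mat_vec_carrier[OF C] unfolding col_space_def cols by auto
  have sub: "vectorspace class_ring (V\<lparr>carrier := W\<rparr>)"
    by (rule subspace_is_vs) (simp only: VectorSpace.subspace_def W vec_vs)
  have basis: "vectorspace.basis class_ring (V\<lparr>carrier := W\<rparr>) (set bs) \<longleftrightarrow>
      lin_indpt (set bs) \<and> span (set bs) = W"
    if "set bs \<subseteq> W"
    unfolding vectorspace.basis_def[OF sub] span_li_not_depend[OF that W] using that by auto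
  have basisW: "set bs \<subseteq> W" if "vectorspace.basis class_ring (V\<lparr>carrier := W\<rparr>) (set bs)"
    using that unfolding vectorspace.basis_def[OF sub] by auto
  have spanW: "set bs \<subseteq> W" if "span (set bs) = W" 
    using that in_own_span[of "set bs"] bs by auto
  have basis: "vectorspace.basis class_ring (V\<lparr>carrier := W\<rparr>) (set bs) \<longleftrightarrow>
      lin_indpt (set bs) \<and> span (set bs) = W"
    using basis basisW spanW by blast
  have li: "lin_indpt (set bs) \<longleftrightarrow> inj_on ((*\<^sub>v) ?C) (carrier_vec ?k)" if d: "distinct bs"
    unfolding inj_on_mult_mat_vec_iff[OF C]
    using lin_depI[OF C, unfolded cols, OF _ _ _ d] lin_depE[OF C, unfolded cols, OF _ d]
    by metis
  have dist: "distinct bs" if inj: "inj_on ((*\<^sub>v) ?C) (carrier_vec ?k)"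
  proof (unfold distinct_conv_nth, intro allI impI)
    fix i j assume ij: "i < ?k" "j < ?k" "i \<noteq> j"
    have u: "?C *\<^sub>v unit_vec ?k i = bs ! i" if "i < ?k" for i
    proof -
      have "?C *\<^sub>v unit_vec ?k i = col ?C i"
        using that by (intro eq_vecI) auto
      then show ?thesis using that bs by (simp add: subset_iff)
    qed
    have "unit_vec ?k i \<noteq> (unit_vec ?k j :: 'a vec)"
      using ij by (metis index_unit_vec(1) index_unit_vec(2) zero_neq_one)
    then show "bs ! i \<noteq> bs ! j" using inj ij unfolding inj_on_def
      by (metis u unit_vec_carrier)
  qed
  show ?thesis unfolding bij_betw_def basis span using li dist by blast
qed

section \<open>Degrees\<close>

text \<open>
  Both \<open>vec_degree\<close> and \<open>mat_degree\<close> are maxima of this shape. The inserted 0 is their value when all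
  entries vanish, in agreement with \<open>degree 0 = 0\<close>.
\<close>

lemma Max_coeff_support_le_iff:
  assumes "finite P"
  shows "Max (insert 0 {i. \<exists>p \<in> P. coeff p i \<noteq> 0}) \<le> d \<longleftrightarrow> (\<forall>p \<in> P. degree (p :: 'a::zero poly) \<le> d)"
proof -
  have "{i. \<exists>p \<in> P. coeff p i \<noteq> 0} \<subseteq> (\<Union>p \<in> P. {..degree p})"
    by (auto simp: le_degree)
  then have "finite {i. \<exists>p \<in> P. coeff p i \<noteq> 0}"
    by (rule finite_subset) (use assms in auto)
  then have "Max (insert 0 {i. \<exists>p \<in> P. coeff p i \<noteq> 0}) \<le> d \<longleftrightarrow>
      (\<forall>i. \<forall>p \<in> P. coeff p i \<noteq> 0 \<longrightarrow> i \<le> d)"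
    by auto
  also have "\<dots> \<longleftrightarrow> (\<forall>p \<in> P. degree p \<le> d)"
  proof (intro iffI ballI allI impI)
    fix p assume "\<forall>i. \<forall>p \<in> P. coeff p i \<noteq> 0 \<longrightarrow> i \<le> d" "p \<in> P"
    then show "degree p \<le> d" by (metis degree_0 le0 leading_coeff_neq_0)
  next
    fix i p assume "\<forall>p \<in> P. degree p \<le> d" "p \<in> P" "coeff p i \<noteq> 0"
    then show "i \<le> d" using le_degree order_trans by blast
  qed
  finally show ?thesis .
qed

lemma vec_degree_le_iff: "vec_degree v \<le> d \<longleftrightarrow> (\<forall>i < dim_vec v. degree (v $ i) \<le> d)"
proof -
  have "{i. map_vec (\<lambda>p. coeff p i) v \<noteq> 0\<^sub>v (dim_vec v)} =
      {i. \<exists>p \<in> set\<^sub>v v. coeff p i \<noteq> 0}"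
    by (auto simp: vec_eq_iff vec_set_def)
  then show ?thesis
    unfolding vec_degree_def using Max_coeff_support_le_iff[of "set\<^sub>v v" d]
    by (auto simp: vec_set_def)
qed

lemma mat_degree_le_iff:
  "mat_degree A \<le> d \<longleftrightarrow> (\<forall>i < dim_row A. \<forall>j < dim_col A. degree (A $$ (i, j)) \<le> d)"
proof -
  let ?P = "(\<lambda>ij. A $$ ij) ` ({..<dim_row A} \<times> {..<dim_col A})"
  have "{i. map_mat (\<lambda>p. coeff p i) A \<noteq> 0\<^sub>m (dim_row A) (dim_col A)} =
      {i. \<exists>p \<in> ?P. coeff p i \<noteq> 0}"
    unfolding mat_eq_iff by simp blast
  then show ?thesis
    unfolding mat_degree_def using Max_coeff_support_le_iff[of ?P d] by auto
qed

lemma degree_le_vec_degree: "i < dim_vec v \<Longrightarrow> degree (v $ i) \<le> vec_degree v"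
  using vec_degree_le_iff[of v "vec_degree v"] by auto

lemma vec_degree_attained:
  assumes "v \<in> carrier_vec n" "v \<noteq> 0\<^sub>v n"
  obtains i where "i < n" "coeff (v $ i) (vec_degree v) \<noteq> 0"
proof (cases "vec_degree v = 0")
  case True
  obtain i where "i < n" "v $ i \<noteq> 0" using assms by (auto simp: vec_eq_iff)
  moreover have "degree (v $ i) = 0" using degree_le_vec_degree[of i v] True \<open>i < n\<close> assms by auto
  ultimately show ?thesis using that[of i] True by (metis leading_coeff_0_iff)
next
  case False
  then have "\<not> vec_degree v \<le> vec_degree v - 1" by simp
  then obtain i where i: "i < n" "\<not> degree (v $ i) \<le> vec_degree v - 1"
    using assms unfolding vec_degree_le_iff by auto
  moreover have "degree (v $ i) \<le> vec_degree v" using degree_le_vec_degree[of i v] i assms by auto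
  ultimately have "degree (v $ i) = vec_degree v" by simp
  with i False show ?thesis using that[of i] by (metis coeff_0 degree_0 leading_coeff_neq_0 le0)
qed

lemma vec_degree_smult:
  assumes "v \<in> carrier_vec n" "v \<noteq> 0\<^sub>v n" "g \<noteq> 0"
  shows "vec_degree (g \<cdot>\<^sub>v v) = degree g + vec_degree (v :: 'a::field poly vec)"
proof (rule antisym)
  show "vec_degree (g \<cdot>\<^sub>v v) \<le> degree g + vec_degree v"
    unfolding vec_degree_le_iff
    by (auto intro!: order_trans[OF degree_mult_le] add_left_mono degree_le_vec_degree)
  obtain i where i: "i < n" "coeff (v $ i) (vec_degree v) \<noteq> 0"
    using vec_degree_attained[OF assms(1,2)] .
  then have "vec_degree v \<le> degree (v $ i)" "v $ i \<noteq> 0" by (auto intro: le_degree)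
  then have "degree g + vec_degree v \<le> degree ((g \<cdot>\<^sub>v v) $ i)"
    using i assms by (simp add: degree_mult_eq)
  also have "\<dots> \<le> vec_degree (g \<cdot>\<^sub>v v)"
    using i assms by (intro degree_le_vec_degree) auto
  finally show "degree g + vec_degree v \<le> vec_degree (g \<cdot>\<^sub>v v)" .
qed

lemma vec_degree_append: "vec_degree (v @\<^sub>v w) = max (vec_degree v) (vec_degree w)"
proof (rule antisym)
  show "vec_degree (v @\<^sub>v w) \<le> max (vec_degree v) (vec_degree w)"
    unfolding vec_degree_le_iff
  proof (intro allI impI)
    fix i assume "i < dim_vec (v @\<^sub>v w)"
    then show "degree ((v @\<^sub>v w) $ i) \<le> max (vec_degree v) (vec_degree w)"
      using degree_le_vec_degree[of i v] degree_le_vec_degree[of "i - dim_vec v" w]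
      by (cases "i < dim_vec v") (auto simp: le_max_iff_disj)
  qed
  have "degree (v $ i) \<le> vec_degree (v @\<^sub>v w)" if "i < dim_vec v" for i
    using degree_le_vec_degree[of i "v @\<^sub>v w"] that by simp
  moreover have "degree (w $ i) \<le> vec_degree (v @\<^sub>v w)" if "i < dim_vec w" for i
    using degree_le_vec_degree[of "dim_vec v + i" "v @\<^sub>v w"] that by simp
  ultimately show "max (vec_degree v) (vec_degree w) \<le> vec_degree (v @\<^sub>v w)"
    by (auto simp: vec_degree_le_iff)
qed

lemma vec_degree_uminus: "vec_degree (- v) = vec_degree v"
proof -
  have "vec_degree (- v) \<le> d \<longleftrightarrow> vec_degree v \<le> d" for d
    by (auto simp: vec_degree_le_iff)
  from this[of "vec_degree v"] this[of "vec_degree (- v)"] show ?thesis by simp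
qed

lemma vec_degree_mult_mat_vec_le:
  assumes "\<And>i j. i < dim_row A \<Longrightarrow> j < dim_col A \<Longrightarrow> degree (A $$ (i, j)) \<le> d"
    and "v \<in> carrier_vec (dim_col A)"
  shows "vec_degree (A *\<^sub>v v) \<le> d + vec_degree v"
  unfolding vec_degree_le_iff
proof (intro allI impI)
  fix i assume i: "i < dim_vec (A *\<^sub>v v)"
  show "degree ((A *\<^sub>v v) $ i) \<le> d + vec_degree v"
    using i assms
    by (auto simp: scalar_prod_def intro!: degree_sum_le order_trans[OF degree_mult_le] add_mono
        degree_le_vec_degree)
qed

lemma has_grade_degree_le:
  assumes "has_grade A g" "i < dim_row A" "j < dim_col A"
  shows "degree (A $$ (i, j)) \<le> g"
proof -
  obtain P :: "nat \<Rightarrow> 'a mat" where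
    "A = mat (dim_row A) (dim_col A) (\<lambda>(r, c). \<Sum>i\<le>g. monom (P i $$ (r, c)) i)"
    using assms(1) unfolding has_grade_def by blast
  then have "A $$ (i, j) = (\<Sum>e\<le>g. monom (P e $$ (i, j)) e)"
    using assms(2,3) by (metis (mono_tags, lifting) case_prod_conv index_mat(1))
  then show ?thesis
    by (auto intro!: degree_sum_le order_trans[OF degree_monom_le])
qed

section \<open>Polynomial vectors among the rational vectors\<close>

lemma rat_vec_mult_mat_vec:
  assumes "dim_vec v = dim_col A"
  shows "rat_mat A *\<^sub>v rat_vec v = rat_vec (A *\<^sub>v v)"
  using to_fract_hom.mult_mat_vec_hom[of A "dim_row A" "dim_col A" v] assms
  by (metis carrier_mat_triv carrier_vec_dim_vec)

lemma rat_mat_of_cols: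
  assumes "set B \<subseteq> carrier_vec q"
  shows "rat_mat (mat_of_cols q B) = mat_of_cols q (map rat_vec B)"
  using assms by (intro eq_matI) (auto simp: mat_of_cols_def subset_iff in_set_conv_nth)

text \<open>
  The product of the denominators of the entries is a common denominator; it is built up over
  initial segments of the vector.
\<close>

lemma common_denominator:
  fixes z :: "'a::field poly fract vec"
  obtains g w where "g \<noteq> 0" "w \<in> carrier_vec (dim_vec z)" "to_fract g \<cdot>\<^sub>v z = rat_vec w"
proof -
  have "\<exists>g. g \<noteq> 0 \<and> (\<forall>i < k. \<exists>p. to_fract g * z $ i = to_fract p)" if "k \<le> dim_vec z" for k
    using that
  proof (induction k)
    case 0
    show ?case by (intro exI[of _ 1]) auto
  next
    case (Suc k)
    then obtain g where g: "g \<noteq> 0" "\<And>i. i < k \<Longrightarrow> \<exists>p. to_fract g * z $ i = to_fract p"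
      by auto
    obtain a b where ab: "b \<noteq> 0" "z $ k = to_fract a / to_fract b"
      by (metis Fract_conv_to_fract Fract_cases)
    show ?case
    proof (rule exI[of _ "g * b"], intro conjI allI impI)
      show "g * b \<noteq> 0" using g ab by simp
      fix i assume "i < Suc k"
      show "\<exists>p. to_fract (g * b) * z $ i = to_fract p"
      proof (cases "i = k")
        case True
        have "to_fract (g * b) * z $ i = to_fract (g * a)" using ab True by simp
        then show ?thesis ..
      next
        case False
        then have "i < k" using \<open>i < Suc k\<close> by simp
        from g(2)[OF this] obtain p where "to_fract g * z $ i = to_fract p" ..
        moreover have "to_fract (g * b) * z $ i = to_fract b * (to_fract g * z $ i)"
          by (simp add: ac_simps)
        ultimately have "to_fract (g * b) * z $ i = to_fract (b * p)" by simp
        then show ?thesis ..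
      qed
    qed
  qed
  from this[OF order_refl] obtain g
    where g: "g \<noteq> 0" "\<forall>i < dim_vec z. \<exists>p. to_fract g * z $ i = to_fract p"
    by (elim exE conjE)
  from g(2) obtain p where p: "\<And>i. i < dim_vec z \<Longrightarrow> to_fract g * z $ i = to_fract (p i)"
    by metis
  show ?thesis
    by (rule that[of g "vec (dim_vec z) p"]) (use g p in auto)
qed

section \<open>Minimal bases whose vectors have one common degree\<close>

abbreviation vec_subspace :: "nat \<Rightarrow> 'b::field vec set \<Rightarrow> bool" where
  "vec_subspace n W \<equiv> submodule class_ring W (module_vec TYPE('b) n)"

text \<open>For a polynomial basis \<open>B\<close> of \<open>W\<close>, this is the coordinate isomorphism onto \<open>W\<close>.\<close>

abbreviation coords_to_vec :: "nat \<Rightarrow> 'a::field poly vec list \<Rightarrow> 'a poly fract vec \<Rightarrow> 'a poly fract vec" where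
  "coords_to_vec q B z \<equiv> rat_mat (mat_of_cols q B) *\<^sub>v z"

lemma polynomial_basis_iff_bij_betw:
  assumes "vec_subspace q W"
  shows "polynomial_basis q W B \<longleftrightarrow> set B \<subseteq> carrier_vec q \<and>
    bij_betw (coords_to_vec q B) (carrier_vec (length B)) W"
proof (cases "set B \<subseteq> carrier_vec q")
  case True
  have "set (map rat_vec B) \<subseteq> carrier_vec q" using True by auto
  from vec_space.basis_iff_bij_betw[OF assms this]
  have "(distinct (map rat_vec B) \<and>
      vectorspace.basis class_ring (module_vec TYPE('a poly fract) q\<lparr>carrier := W\<rparr>) (rat_vec ` set B))
    \<longleftrightarrow> bij_betw (coords_to_vec q B) (carrier_vec (length B)) W"
    by (simp add: rat_mat_of_cols[OF True])
  moreover have "distinct (map rat_vec B) \<longleftrightarrow> distinct B"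
    by (simp add: distinct_map inj_on_def) (metis to_fract_hom.vec_hom_inj)
  ultimately show ?thesis unfolding polynomial_basis_def using True by blast
qed (auto simp: polynomial_basis_def)

lemma polynomial_basis_length_unique:
  assumes W: "vec_subspace q W"
    and B: "polynomial_basis q W B" and C: "polynomial_basis q W C"
  shows "length B = length C"
proof -
  let ?V = "module_vec TYPE('a poly fract) q\<lparr>carrier := W\<rparr>"
  have sub: "vectorspace class_ring ?V"
    by (rule vectorspace.subspace_is_vs[OF vec_vs]) (simp only: VectorSpace.subspace_def W vec_vs)
  have "vectorspace.dim class_ring ?V = length D" if D: "polynomial_basis q W D" for D
  proof -
    have "vectorspace.dim class_ring ?V = card (rat_vec ` set D)"
      using D unfolding polynomial_basis_def by (intro vectorspace.dim_basis[OF sub]) auto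
    also have "\<dots> = length D"
      using D unfolding polynomial_basis_def
      by (metis card_image distinct_card inj_onI to_fract_hom.vec_hom_inj)
    finally show ?thesis .
  qed
  then show ?thesis using B C by metis
qed

lemma mult_mat_of_cols_index:
  assumes "i < n" "z \<in> carrier_vec (length B)"
  shows "(mat_of_cols n B *\<^sub>v z) $ i = (\<Sum>j < length B. B ! j $ i * z $ j)"
  using assms by (simp add: scalar_prod_def mat_of_cols_def atLeast0LessThan)

text \<open>
  The Steinitz exchange. Replacing the basis vector at \<open>j\<close> by \<open>u\<close> composes the coordinate isomorphism
  with the map \<open>E\<close> that replaces the unit vector at \<open>j\<close> by \<open>z\<close>; since the entry of \<open>z\<close> at \<open>j\<close> is
  nonzero, \<open>E\<close> is invertible, with inverse \<open>F\<close>.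
\<close>

lemma bij_betw_exchange:
  fixes bs :: "'b::field vec list"
  assumes bij: "bij_betw ((*\<^sub>v) (mat_of_cols n bs)) (carrier_vec (length bs)) W"
    and z: "z \<in> carrier_vec (length bs)" and j: "j < length bs" "z $ j \<noteq> 0"
    and u: "u = mat_of_cols n bs *\<^sub>v z"
  shows "bij_betw ((*\<^sub>v) (mat_of_cols n (bs[j := u]))) (carrier_vec (length bs)) W"
proof -
  let ?k = "length bs"
  define E where "E x = vec ?k (\<lambda>i. if i = j then x $ j * z $ j else x $ i + x $ j * z $ i)" for x
  define F where "F y = vec ?k (\<lambda>i. if i = j then y $ j / z $ j else y $ i - y $ j / z $ j * z $ i)" for y
  have "bij_betw E (carrier_vec ?k) (carrier_vec ?k)"
    by (rule bij_betw_byWitness[where f' = F])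
      (use j in \<open>auto simp: E_def F_def vec_eq_iff\<close>)
  then have "bij_betw ((*\<^sub>v) (mat_of_cols n bs) \<circ> E) (carrier_vec ?k) W"
    using bij by (rule bij_betw_trans)
  moreover have "mat_of_cols n bs *\<^sub>v E x = mat_of_cols n (bs[j := u]) *\<^sub>v x"
    if x: "x \<in> carrier_vec ?k" for x
  proof (rule eq_vecI)
    fix i assume "i < dim_vec (mat_of_cols n (bs[j := u]) *\<^sub>v x)"
    then have i: "i < n" by simp
    have Ex: "E x \<in> carrier_vec ?k" by (simp add: E_def)
    have "(mat_of_cols n bs *\<^sub>v E x) $ i =
        bs ! j $ i * (x $ j * z $ j) + (\<Sum>l \<in> {..<?k} - {j}. bs ! l $ i * (x $ l + x $ j * z $ l))"
      unfolding mult_mat_of_cols_index[OF i Ex] using j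
      by (subst sum.remove[of _ j]) (auto simp: E_def intro!: sum.cong)
    also have "\<dots> = x $ j * (bs ! j $ i * z $ j + (\<Sum>l \<in> {..<?k} - {j}. bs ! l $ i * z $ l)) +
        (\<Sum>l \<in> {..<?k} - {j}. bs ! l $ i * x $ l)"
      by (simp add: algebra_simps sum.distrib sum_distrib_left)
    also have "bs ! j $ i * z $ j + (\<Sum>l \<in> {..<?k} - {j}. bs ! l $ i * z $ l) = u $ i"
      unfolding u mult_mat_of_cols_index[OF i z] using j by (subst (2) sum.remove[of _ j]) auto
    also have "x $ j * u $ i + (\<Sum>l \<in> {..<?k} - {j}. bs ! l $ i * x $ l) =
        (\<Sum>l < ?k. bs[j := u] ! l $ i * x $ l)"
      using j by (subst (2) sum.remove[of _ j]) (auto intro!: sum.cong)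
    also have "\<dots> = (mat_of_cols n (bs[j := u]) *\<^sub>v x) $ i"
      using mult_mat_of_cols_index[OF i, of x "bs[j := u]"] x by simp
    finally show "(mat_of_cols n bs *\<^sub>v E x) $ i = (mat_of_cols n (bs[j := u]) *\<^sub>v x) $ i" .
  qed simp
  ultimately show ?thesis
    by (subst bij_betw_cong[of _ _ "(*\<^sub>v) (mat_of_cols n bs) \<circ> E"]) auto
qed

text \<open>
  Exchanging a basis vector that occurs in the expansion of \<open>u\<close> for \<open>u\<close> gives another basis, whose
  degree sum must not be smaller.
\<close>

lemma minimal_basis_exchange:
  assumes W: "vec_subspace q W" and B: "minimal_basis q W B"
    and u: "u \<in> carrier_vec q" "rat_vec u = coords_to_vec q B z"
    and z: "z \<in> carrier_vec (length B)" and j: "j < length B" "z $ j \<noteq> 0"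
  shows "u \<noteq> 0\<^sub>v q" "vec_degree (B ! j) \<le> vec_degree u"
proof -
  have pB: "polynomial_basis q W B" using B by (simp add: minimal_basis_def)
  then have Bq: "set B \<subseteq> carrier_vec q"
    and bij: "bij_betw (coords_to_vec q B) (carrier_vec (length B)) W"
    unfolding polynomial_basis_iff_bij_betw[OF W] by auto
  show "u \<noteq> 0\<^sub>v q"
  proof
    assume "u = 0\<^sub>v q"
    then have "coords_to_vec q B z = 0\<^sub>v q" using u by (metis to_fract_hom.vec_hom_zero)
    moreover have "coords_to_vec q B (0\<^sub>v (length B)) = 0\<^sub>v q" by (intro eq_vecI) auto
    ultimately have "z = 0\<^sub>v (length B)"
      using bij z unfolding bij_betw_def inj_on_def by (metis zero_carrier_vec)
    then show False using j by simp
  qed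
  have C: "set (B[j := u]) \<subseteq> carrier_vec q"
    using Bq u(1) by (meson insert_subset order_trans set_update_subset_insert)
  have "bij_betw (coords_to_vec q (B[j := u])) (carrier_vec (length B)) W"
    using bij_betw_exchange[of q "map rat_vec B" W z j "rat_vec u"] bij z j u
    unfolding rat_mat_of_cols[OF Bq] rat_mat_of_cols[OF C] by (simp add: map_update)
  with C have "polynomial_basis q W (B[j := u])"
    unfolding polynomial_basis_iff_bij_betw[OF W] by simp
  then have "sum_list (map vec_degree B) \<le> sum_list (map vec_degree (B[j := u]))"
    using B unfolding minimal_basis_def by blast
  also have "\<dots> = sum_list (map vec_degree B) + vec_degree u - vec_degree (B ! j)"
    using j by (simp add: map_update sum_list_update)
  finally show "vec_degree (B ! j) \<le> vec_degree u"
    using elem_le_sum_list[of j "map vec_degree B"] j by simp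
qed

lemma coeff_mult_bounds:
  assumes "degree p \<le> d" "degree r \<le> e"
  shows "coeff (p * r) (d + e) = coeff p d * coeff (r :: 'a::comm_semiring_0 poly) e"
proof (cases "degree p = d \<and> degree r = e")
  case True
  then show ?thesis by (metis coeff_mult_degree_sum)
next
  case False
  then have "degree (p * r) < d + e"
    using assms degree_mult_le[of p r] by linarith
  moreover have "coeff p d = 0 \<or> coeff r e = 0"
    using False assms by (meson coeff_eq_0 le_neq_implies_less)
  ultimately show ?thesis by (auto simp: coeff_eq_0)
qed

text \<open>
  The second conjunct is the predictable degree property for columns of equal degree \<open>d\<close>. The third
  says that \<open>C\<close> is irreducible: only polynomial vectors have polynomial images. Injectivity is
  demanded separately because for \<open>d = 0\<close> the second conjunct does not exclude \<open>C w = 0\<close> with a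
  constant \<open>w \<noteq> 0\<close>, the degree of the zero vector being 0.
\<close>

definition shifts_degree :: "nat \<Rightarrow> 'a::field poly mat \<Rightarrow> bool" where
  "shifts_degree d C \<longleftrightarrow>
    inj_on ((*\<^sub>v) (rat_mat C)) (carrier_vec (dim_col C)) \<and>
    (\<forall>w \<in> carrier_vec (dim_col C). w \<noteq> 0\<^sub>v (dim_col C) \<longrightarrow> vec_degree (C *\<^sub>v w) = d + vec_degree w) \<and>
    (\<forall>z \<in> carrier_vec (dim_col C). \<forall>v. rat_mat C *\<^sub>v z = rat_vec v \<longrightarrow>
      (\<exists>w \<in> carrier_vec (dim_col C). z = rat_vec w))"

context
  fixes q :: nat and W :: "'a::field poly fract vec set" and B :: "'a poly vec list" and d :: nat
  assumes W: "vec_subspace q W" and B: "minimal_basis q W B"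
    and deg: "\<And>b. b \<in> set B \<Longrightarrow> vec_degree b = d"
begin

lemma uniform_basis_carrier: "set B \<subseteq> carrier_vec q"
  using B by (simp add: minimal_basis_def polynomial_basis_def)

lemma uniform_basis_entry_degree:
  assumes "i < q" "j < length B"
  shows "degree (mat_of_cols q B $$ (i, j)) \<le> d"
proof -
  have "B ! j \<in> set B" using assms by simp
  then have "vec_degree (B ! j) = d" "dim_vec (B ! j) = q"
    using deg uniform_basis_carrier by auto
  then show ?thesis
    using degree_le_vec_degree[of i "B ! j"] assms by (simp add: mat_of_cols_def)
qed

lemma uniform_basis_degree_le:
  "w \<in> carrier_vec (length B) \<Longrightarrow> vec_degree (mat_of_cols q B *\<^sub>v w) \<le> d + vec_degree w"
  by (rule vec_degree_mult_mat_vec_le) (auto intro: uniform_basis_entry_degree)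

lemma uniform_basis_exchange:
  assumes "u \<in> carrier_vec q" "rat_vec u = coords_to_vec q B z"
    "z \<in> carrier_vec (length B)" "z \<noteq> 0\<^sub>v (length B)"
  shows "u \<noteq> 0\<^sub>v q" "d \<le> vec_degree u"
proof -
  obtain j where "j < length B" "z $ j \<noteq> 0"
    using assms by (auto simp: vec_eq_iff)
  with minimal_basis_exchange[OF W B assms(1-3)] deg[of "B ! j"]
  show "u \<noteq> 0\<^sub>v q" "d \<le> vec_degree u" by auto
qed

text \<open>
  Let \<open>e\<close> be the degree of \<open>w\<close>, and let \<open>c\<close> be the constant vector of the coefficients of \<open>w\<close> at
  exponent \<open>e\<close>. The vector of coefficients of \<open>C w\<close> at \<open>d + e\<close> equals that of \<open>C c\<close> at \<open>d\<close>. If it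
  were zero, then \<open>C c\<close> would have degree below \<open>d\<close> or be zero, and the exchange lemma rules out
  both.
\<close>

lemma uniform_basis_predictable_degree:
  assumes w: "w \<in> carrier_vec (length B)" "w \<noteq> 0\<^sub>v (length B)"
  shows "vec_degree (mat_of_cols q B *\<^sub>v w) = d + vec_degree w"
proof (rule antisym[OF uniform_basis_degree_le[OF w(1)]])
  let ?C = "mat_of_cols q B" and ?e = "vec_degree w"
  define c where "c = map_vec (\<lambda>p. [:coeff p ?e:]) w"
  define u where "u = ?C *\<^sub>v c"
  have c: "c \<in> carrier_vec (length B)" using w by (simp add: c_def)
  obtain j where j: "j < length B" "coeff (w $ j) ?e \<noteq> 0"
    using vec_degree_attained[OF w] .
  have u: "u \<in> carrier_vec q" unfolding u_def by (rule carrier_vecI) simp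
  have "rat_vec c $ j \<noteq> 0" using j w by (simp add: c_def)
  then have "rat_vec c \<noteq> 0\<^sub>v (length B)" using j by auto
  moreover have "rat_vec u = coords_to_vec q B (rat_vec c)"
    unfolding u_def using c by (subst rat_vec_mult_mat_vec) auto
  ultimately have u0: "u \<noteq> 0\<^sub>v q" and "d \<le> vec_degree u"
    using uniform_basis_exchange[OF u, of "rat_vec c"] c by auto
  moreover have "vec_degree c \<le> 0"
    unfolding vec_degree_le_iff by (simp add: c_def)
  ultimately have "vec_degree u = d"
    using uniform_basis_degree_le[OF c] unfolding u_def by simp
  with vec_degree_attained[OF u u0] obtain i where i: "i < q" "coeff (u $ i) d \<noteq> 0"
    by metis
  have "coeff ((?C *\<^sub>v w) $ i) (d + ?e) = (\<Sum>l < length B. coeff (?C $$ (i, l)) d * coeff (w $ l) ?e)"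
    using i(1) w uniform_basis_entry_degree[OF i(1)] degree_le_vec_degree[of _ w]
    by (simp add: scalar_prod_def coeff_sum coeff_mult_bounds atLeast0LessThan)
  also have "\<dots> = coeff (u $ i) d"
    using i(1) w by (simp add: u_def c_def scalar_prod_def coeff_sum atLeast0LessThan mult.commute)
  finally have "coeff ((?C *\<^sub>v w) $ i) (d + ?e) \<noteq> 0" using i by simp
  then have "d + ?e \<le> degree ((?C *\<^sub>v w) $ i)" by (rule le_degree)
  also have "\<dots> \<le> vec_degree (?C *\<^sub>v w)" using i by (intro degree_le_vec_degree) simp
  finally show "d + ?e \<le> vec_degree (?C *\<^sub>v w)" .
qed

text \<open>
  Write \<open>z = w / g\<close> with a common denominator \<open>g\<close> and divide with remainder, \<open>w = g a + r\<close>. If \<open>r\<close>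
  were nonzero, then \<open>u = v - C a = C (r / g)\<close> would be a polynomial vector of \<open>W\<close> of degree at most
  \<open>d + deg r - deg g < d\<close>, contradicting the exchange lemma. So \<open>g\<close> divides \<open>w\<close>.
\<close>

lemma uniform_basis_polynomial_coordinates:
  assumes z: "z \<in> carrier_vec (length B)" and v: "coords_to_vec q B z = rat_vec v"
  shows "\<exists>w \<in> carrier_vec (length B). z = rat_vec w"
proof -
  let ?C = "mat_of_cols q B" let ?k = "length B"
  have vq: "v \<in> carrier_vec q"
    using arg_cong[OF v, of dim_vec] by (intro carrier_vecI) simp
  obtain g w where g: "g \<noteq> 0" and w: "w \<in> carrier_vec ?k" "to_fract g \<cdot>\<^sub>v z = rat_vec w"
    using common_denominator[of z] z by auto
  define a where "a = map_vec (\<lambda>p. p div g) w"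
  define r where "r = map_vec (\<lambda>p. p mod g) w"
  have a: "a \<in> carrier_vec ?k" and r: "r \<in> carrier_vec ?k"
    using w by (simp_all add: a_def r_def)
  have gz: "to_fract g * z $ i = to_fract (w $ i)" if "i < ?k" for i
  proof -
    have "to_fract g * z $ i = (to_fract g \<cdot>\<^sub>v z) $ i" using that z by simp
    also have "\<dots> = to_fract (w $ i)" unfolding w(2) using that w(1) by simp
    finally show ?thesis .
  qed
  have wi: "w $ i = g * a $ i + r $ i" if "i < ?k" for i
    using that w by (simp add: a_def r_def)
  have "r = 0\<^sub>v ?k"
  proof (rule ccontr)
    assume r0: "r \<noteq> 0\<^sub>v ?k"
    define u where "u = v - ?C *\<^sub>v a"
    \<comment> \<open>\<open>y = r / g\<close>, see \<open>gy\<close>\<close>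
    define y where "y = z - rat_vec a"
    have u: "u \<in> carrier_vec q" unfolding u_def using vq by (intro carrier_vecI) simp
    have y: "y \<in> carrier_vec ?k" unfolding y_def using z a by auto
    have gy: "to_fract g * y $ i = to_fract (r $ i)" if "i < ?k" for i
      using that gz[OF that] wi[OF that] z a by (simp add: y_def algebra_simps)
    have "y \<noteq> 0\<^sub>v ?k"
    proof
      assume "y = 0\<^sub>v ?k"
      then have "r $ i = 0" if "i < ?k" for i using gy[OF that] that by simp
      then show False using r0 r by (auto simp: vec_eq_iff)
    qed
    moreover have uy: "rat_vec u = coords_to_vec q B y"
    proof -
      have "coords_to_vec q B y = coords_to_vec q B z - coords_to_vec q B (rat_vec a)"
        unfolding y_def using z a by (intro mult_minus_distrib_mat_vec[of _ q ?k]) auto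
      also have "\<dots> = rat_vec v - rat_vec (?C *\<^sub>v a)"
        unfolding v using a by (subst rat_vec_mult_mat_vec) auto
      also have "\<dots> = rat_vec u" unfolding u_def using vq by (intro eq_vecI) auto
      finally show ?thesis by simp
    qed
    ultimately have u0: "u \<noteq> 0\<^sub>v q" and du: "d \<le> vec_degree u"
      using uniform_basis_exchange[OF u _ y] by auto
    have "rat_vec (?C *\<^sub>v r) = rat_vec (g \<cdot>\<^sub>v u)"
    proof -
      have "rat_vec r = to_fract g \<cdot>\<^sub>v y" using gy y r by (intro eq_vecI) auto
      then have "rat_vec (?C *\<^sub>v r) = coords_to_vec q B (to_fract g \<cdot>\<^sub>v y)"
        using r by (subst rat_vec_mult_mat_vec[symmetric]) auto
      also have "\<dots> = to_fract g \<cdot>\<^sub>v rat_vec u"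
        unfolding uy using y by (intro mult_mat_vec[of _ q ?k]) auto
      finally show ?thesis by (simp add: to_fract_hom.vec_hom_smult)
    qed
    then have "?C *\<^sub>v r = g \<cdot>\<^sub>v u" by (rule to_fract_hom.vec_hom_inj)
    then have "degree g + vec_degree u = vec_degree (?C *\<^sub>v r)"
      using vec_degree_smult[OF u u0 g] by simp
    also have "\<dots> \<le> d + vec_degree r" by (rule uniform_basis_degree_le[OF r])
    finally have "degree g \<le> vec_degree r" using du by simp
    moreover obtain i where i: "i < ?k" "coeff (r $ i) (vec_degree r) \<noteq> 0"
      using vec_degree_attained[OF r r0] .
    moreover have "r $ i = 0 \<or> degree (r $ i) < degree g"
      using i w degree_mod_less[OF g, of "w $ i"] by (simp add: r_def)
    ultimately show False by (metis coeff_0 le_degree leD order_trans)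
  qed
  then have "z = rat_vec a"
    using gz wi g z a by (intro eq_vecI) auto
  with a show ?thesis by blast
qed

lemma uniform_minimal_basis_shifts_degree: "shifts_degree d (mat_of_cols q B)"
proof -
  have "bij_betw (coords_to_vec q B) (carrier_vec (length B)) W"
    using B polynomial_basis_iff_bij_betw[OF W] by (simp add: minimal_basis_def)
  then show ?thesis
    unfolding shifts_degree_def bij_betw_def
    using uniform_basis_predictable_degree uniform_basis_polynomial_coordinates by simp
qed

end

lemma shifts_degree_one: "shifts_degree 0 (1\<^sub>m n)"
proof -
  have "rat_mat (1\<^sub>m n) = (1\<^sub>m n :: 'a poly fract mat)" by (rule to_fract_hom.mat_hom_one)
  then show ?thesis unfolding shifts_degree_def
    by (auto simp: inj_on_def dest: arg_cong[of _ _ dim_vec])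
qed

section \<open>Kernel and range of complementary matrices\<close>

lemma mat_kernel_subspace:
  assumes "A \<in> carrier_mat nr nc"
  shows "vec_subspace nc (mat_kernel (A :: 'b::field mat))"
proof -
  interpret vec_space "TYPE('b)" nc .
  show ?thesis
    by unfold_locales
      (use assms mat_kernel[OF assms] mult_add_distrib_mat_vec[OF assms] mult_mat_vec[OF assms]
        in \<open>auto simp: module_vec_simps class_ring_simps\<close>)
qed

lemma row_space_eq_range:
  assumes "A \<in> carrier_mat k n"
  shows "vec_space.row_space n (A :: 'b::field mat) = (*\<^sub>v) A\<^sup>T ` carrier_vec k"
  using vec_space.row_space_eq[OF assms] assms by auto

lemma row_space_subspace:
  assumes "A \<in> carrier_mat k n"
  shows "vec_subspace n (vec_space.row_space n (A :: 'b::field mat))"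
proof -
  interpret vec_space "TYPE('b)" n .
  show ?thesis
    unfolding row_space_def using assms by (intro span_is_submodule) (auto simp: rows_def)
qed

lemma mat_of_cols_rows:
  assumes "A \<in> carrier_mat k n"
  shows "mat_of_cols n (rows A) = A\<^sup>T"
  using mat_of_cols_cols[of "A\<^sup>T"] assms by simp

text \<open>
  The range of \<open>N\<^sup>T\<close> has dimension \<open>b\<close> and is contained in the kernel of \<open>K\<close>. It is the whole kernel,
  because a row echelon form of \<open>K\<close> has no zero row (such a row would be a linear dependency between
  the rows of \<open>K\<close>), so that the kernel has dimension \<open>b\<close> as well.
\<close>

lemma mat_kernel_eq_range_transpose:
  fixes K N :: "'b::field mat"
  assumes K: "K \<in> carrier_mat a (a + b)" and N: "N \<in> carrier_mat b (a + b)"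
    and KN: "K * N\<^sup>T = 0\<^sub>m a b"
    and injK: "inj_on ((*\<^sub>v) K\<^sup>T) (carrier_vec a)" and injN: "inj_on ((*\<^sub>v) N\<^sup>T) (carrier_vec b)"
  shows "mat_kernel K = (*\<^sub>v) N\<^sup>T ` carrier_vec b"
proof -
  let ?q = "a + b"
  interpret kernel a ?q K by unfold_locales (rule K)
  define C where "C = gauss_jordan_single K"
  note gj = gauss_jordan_single[OF K C_def[symmetric]]
  obtain P Q where P: "P \<in> carrier_mat a a" and Q: "Q \<in> carrier_mat a a"
    and C: "C = P * K" and PQ: "P * Q = 1\<^sub>m a" and QP: "Q * P = 1\<^sub>m a"
    using gj(4) by blast
  \<comment> \<open>Row \<open>i\<close> of \<open>C\<close> combines the rows of \<open>K\<close> with the coefficients in row \<open>i\<close> of the invertible \<open>P\<close>.\<close>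
  have "row C i \<noteq> 0\<^sub>v ?q" if i: "i < a" for i
  proof
    assume row: "row C i = 0\<^sub>v ?q"
    have "K\<^sup>T *\<^sub>v row P i = row C i"
      unfolding C using i P K by (intro eq_vecI) (auto simp: comm_scalar_prod[of _ a])
    also have "\<dots> = K\<^sup>T *\<^sub>v 0\<^sub>v a"
      unfolding row using K by (intro eq_vecI) auto
    finally have "row P i = 0\<^sub>v a"
      using injK P i by (metis inj_onD row_carrier_vec zero_carrier_vec)
    then have "(P * Q) $$ (i, i) = 0" using i P Q by simp
    then show False unfolding PQ using i by simp
  qed
  then have "{i. i < a \<and> row C i \<noteq> 0\<^sub>v ?q} = {..<a}" by auto
  then have "kernel.dim ?q C = b"
    using find_base_vectors(6)[OF gj(3,2)] by simp
  moreover have "mat_kernel C = mat_kernel K"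
    unfolding C by (rule mat_kernel_mult_eq[OF K P Q QP])
  ultimately have dimK: "dim = b" by simp
  have Nt: "N\<^sup>T \<in> carrier_mat ?q b" using N by simp
  have sub: "vec_subspace ?q ((*\<^sub>v) N\<^sup>T ` carrier_vec b)"
    using row_space_subspace[OF N] unfolding row_space_eq_range[OF N] .
  have bij: "bij_betw ((*\<^sub>v) (mat_of_cols ?q (rows N))) (carrier_vec (length (rows N))) ((*\<^sub>v) N\<^sup>T ` carrier_vec b)"
    using injN N unfolding bij_betw_def mat_of_cols_rows[OF N] by simp
  have rows_carrier: "set (rows N) \<subseteq> carrier_vec ?q" using N by (auto simp: rows_def)
  have rows_ker: "set (rows N) \<subseteq> mat_kernel K"
  proof
    fix v assume "v \<in> set (rows N)"
    then obtain j where j: "j < b" "v = row N j" using N by (auto simp: rows_def)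
    have "K *\<^sub>v row N j = col (K * N\<^sup>T) j" using j K N by (intro eq_vecI) auto
    also have "\<dots> = 0\<^sub>v a" unfolding KN using j by simp
    finally show "v \<in> mat_kernel K" using j N by (intro mat_kernelI[OF K]) auto
  qed
  have basisN: "distinct (rows N)"
    "vectorspace.basis class_ring (module_vec TYPE('b) ?q\<lparr>carrier := (*\<^sub>v) N\<^sup>T ` carrier_vec b\<rparr>) (set (rows N))"
    using vec_space.basis_iff_bij_betw[OF sub rows_carrier] bij by auto
  have vs: "vectorspace class_ring (module_vec TYPE('b) ?q\<lparr>carrier := (*\<^sub>v) N\<^sup>T ` carrier_vec b\<rparr>)"
    by (rule NC.subspace_is_vs) (simp only: VectorSpace.subspace_def sub vec_vs)
  have rows_range: "set (rows N) \<subseteq> (*\<^sub>v) N\<^sup>T ` carrier_vec b"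
    using basisN(2) unfolding vectorspace.basis_def[OF vs] by auto
  have span: "NC.span (set (rows N)) = (*\<^sub>v) N\<^sup>T ` carrier_vec b"
    and li: "NC.lin_indpt (set (rows N))"
    using basisN(2) unfolding vectorspace.basis_def[OF vs]
    using NC.span_li_not_depend[OF rows_range sub] by auto
  have "basis (set (rows N))"
  proof (rule Ker.dim_li_is_basis)
    show "Ker.fin_dim" 
      using kernel_basis_exists[OF K] by (metis Ker.basis_def Ker.fin_dim_def)
    show "card (set (rows N)) \<ge> dim" using dimK basisN(1) N by (simp add: distinct_card)
    show "lin_indpt (set (rows N))" using li lindep_same[OF rows_ker] by simp
  qed (use rows_ker in auto)
  then have "span (set (rows N)) = mat_kernel K" by (simp add: Ker.basis_def)
  then show ?thesis using span_same[OF rows_ker] span by simp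
qed

section \<open>Transfer of minimal indices\<close>

lemma mult_mat_of_cols_mem_subspace:
  assumes W: "vec_subspace n (W :: 'b::field vec set)" and bs: "set bs \<subseteq> W"
    and z: "z \<in> carrier_vec (length bs)"
  shows "mat_of_cols n bs *\<^sub>v z \<in> W"
proof -
  interpret vec_space "TYPE('b)" n .
  have W': "W \<subseteq> carrier_vec n" using submodule.subset[OF W] by simp
  then have c: "set bs \<subseteq> carrier_vec n" using bs by auto
  have "mat_of_cols n bs *\<^sub>v z \<in> col_space (mat_of_cols n bs)"
    using z mult_mat_vec_carrier[of "mat_of_cols n bs" n "length bs" z]
    by (subst col_space_eq[of _ "length bs"]) auto
  also have "\<dots> = span (set bs)" unfolding col_space_def using c by simp
  also have "\<dots> \<subseteq> W" using bs W by (rule span_is_subset)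
  finally show ?thesis .
qed

text \<open>
  The matrices \<open>A\<close> and \<open>A'\<close> identify \<open>W\<close> and \<open>W'\<close> with one common space, and so with each other.
  An isomorphism \<open>W \<rightarrow> W'\<close> is described in this symmetric way because in the application neither
  it nor its inverse is given by a matrix at hand, while \<open>A = N1\<^sup>T\<close> and the projection
  \<open>A'\<close> to the first block are. By the symmetry, bases can be moved in both directions.
\<close>

lemma bij_betw_transfer:
  fixes A A' :: "'b::field mat"
  assumes W': "vec_subspace q W'"
    and A: "A \<in> carrier_mat r p" "inj_on ((*\<^sub>v) A) W"
    and A': "A' \<in> carrier_mat r q" "inj_on ((*\<^sub>v) A') W'"
    and AW: "(*\<^sub>v) A ` W = (*\<^sub>v) A' ` W'"
    and bs: "set bs \<subseteq> carrier_vec p" and bs': "set bs' \<subseteq> W'"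
    and len: "length bs' = length bs"
    and rel: "\<And>i. i < length bs \<Longrightarrow> A *\<^sub>v bs ! i = A' *\<^sub>v bs' ! i"
    and bij: "bij_betw ((*\<^sub>v) (mat_of_cols p bs)) (carrier_vec (length bs)) W"
  shows "bij_betw ((*\<^sub>v) (mat_of_cols q bs')) (carrier_vec (length bs')) W'"
proof -
  let ?C = "mat_of_cols p bs" and ?C' = "mat_of_cols q bs'" and ?k = "length bs"
  have W'q: "W' \<subseteq> carrier_vec q" using submodule.subset[OF W'] by (simp add: module_vec_simps)
  have "A * ?C = A' * ?C'"
  proof (rule eq_matI)
    fix i j assume "i < dim_row (A' * ?C')" "j < dim_col (A' * ?C')"
    then have ij: "i < r" "j < ?k" using A' len by auto
    have "bs ! j \<in> carrier_vec p" "bs' ! j \<in> carrier_vec q"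
      using ij len bs bs' W'q by (metis nth_mem subsetD)+
    then have "(A * ?C) $$ (i, j) = (A *\<^sub>v bs ! j) $ i" "(A' * ?C') $$ (i, j) = (A' *\<^sub>v bs' ! j) $ i"
      using ij A A' len by simp_all
    then show "(A * ?C) $$ (i, j) = (A' * ?C') $$ (i, j)" using rel[OF ij(2)] by simp
  qed (use A A' len in auto)
  moreover have "?C \<in> carrier_mat p ?k" by simp
  moreover have "?C' \<in> carrier_mat q ?k" using len by (metis mat_of_cols_carrier(1))
  ultimately have eq: "A *\<^sub>v (?C *\<^sub>v z) = A' *\<^sub>v (?C' *\<^sub>v z)" if "z \<in> carrier_vec ?k" for z
    using that A(1) A'(1) by (metis assoc_mult_mat_vec)
  have mem: "?C *\<^sub>v z \<in> W" "?C' *\<^sub>v z \<in> W'" if "z \<in> carrier_vec ?k" for z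
    using that bij mult_mat_of_cols_mem_subspace[OF W' bs', of z] len
    unfolding bij_betw_def by auto
  have "inj_on ((*\<^sub>v) ?C') (carrier_vec ?k)"
  proof (rule inj_onI)
    fix x y assume "x \<in> carrier_vec ?k" "y \<in> carrier_vec ?k" "?C' *\<^sub>v x = ?C' *\<^sub>v y"
    then show "x = y" using eq mem A(2) bij unfolding bij_betw_def inj_on_def by metis
  qed
  moreover have "(*\<^sub>v) ?C' ` carrier_vec ?k = W'"
  proof (intro equalityI subsetI)
    fix w' assume w': "w' \<in> W'"
    then obtain w where w: "w \<in> W" "A' *\<^sub>v w' = A *\<^sub>v w" using AW by blast
    then obtain z where z: "z \<in> carrier_vec ?k" "w = ?C *\<^sub>v z"
      using bij unfolding bij_betw_def by blast
    then have "A' *\<^sub>v w' = A' *\<^sub>v (?C' *\<^sub>v z)" using eq w by simp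
    then have "w' = ?C' *\<^sub>v z" using A'(2) w' mem(2)[OF z(1)] unfolding inj_on_def by blast
    with z show "w' \<in> (*\<^sub>v) ?C' ` carrier_vec ?k" by blast
  qed (use mem in auto)
  ultimately show ?thesis unfolding bij_betw_def len by simp
qed

text \<open>
  The relation \<open>R\<close> lets the lift of the basis vectors carry along how it changes their degrees.
\<close>

lemma polynomial_basis_transfer:
  fixes A A' :: "'a::field poly fract mat"
  assumes W: "vec_subspace p W" and W': "vec_subspace q W'"
    and A: "A \<in> carrier_mat r p" "inj_on ((*\<^sub>v) A) W"
    and A': "A' \<in> carrier_mat r q" "inj_on ((*\<^sub>v) A') W'"
    and AW: "(*\<^sub>v) A ` W = (*\<^sub>v) A' ` W'"
    and lift: "\<And>b. b \<in> carrier_vec p \<Longrightarrow> b \<noteq> 0\<^sub>v p \<Longrightarrow> rat_vec b \<in> W \<Longrightarrow>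
      \<exists>b'. b' \<in> carrier_vec q \<and> rat_vec b' \<in> W' \<and> A *\<^sub>v rat_vec b = A' *\<^sub>v rat_vec b' \<and> R b b'"
    and B: "polynomial_basis p W B"
  obtains B' where "polynomial_basis q W' B'" "list_all2 R B B'"
proof -
  have Bp: "set B \<subseteq> carrier_vec p"
    and bij: "bij_betw (coords_to_vec p B) (carrier_vec (length B)) W"
    using B unfolding polynomial_basis_iff_bij_betw[OF W] by auto
  have "\<exists>b'. b' \<in> carrier_vec q \<and> rat_vec b' \<in> W' \<and> A *\<^sub>v rat_vec b = A' *\<^sub>v rat_vec b' \<and> R b b'"
    if "b \<in> set B" for b
  proof (rule lift)
    let ?V = "module_vec TYPE('a poly fract) p"
    have vs: "vectorspace class_ring (?V\<lparr>carrier := W\<rparr>)"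
      by (rule vectorspace.subspace_is_vs[OF vec_vs]) (simp only: VectorSpace.subspace_def W vec_vs)
    have basis: "vectorspace.basis class_ring (?V\<lparr>carrier := W\<rparr>) (rat_vec ` set B)"
      using B by (simp add: polynomial_basis_def)
    show "b \<in> carrier_vec p" using that Bp by auto
    show "rat_vec b \<in> W" using basis that unfolding vectorspace.basis_def[OF vs] by auto
    have "\<zero>\<^bsub>?V\<lparr>carrier := W\<rparr>\<^esub> \<notin> rat_vec ` set B"
      using basis unfolding vectorspace.basis_def[OF vs]
      by (intro vectorspace.vs_zero_lin_dep[OF vs]) auto
    then show "b \<noteq> 0\<^sub>v p"
      using that by (auto simp: module_vec_simps to_fract_hom.vec_hom_zero image_iff)
  qed
  then obtain f where f: "\<And>b. b \<in> set B \<Longrightarrow>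
      f b \<in> carrier_vec q \<and> rat_vec (f b) \<in> W' \<and> A *\<^sub>v rat_vec b = A' *\<^sub>v rat_vec (f b) \<and> R b (f b)"
    by metis
  have B'q: "set (map f B) \<subseteq> carrier_vec q" using f by auto
  have "bij_betw ((*\<^sub>v) (mat_of_cols q (map rat_vec (map f B)))) (carrier_vec (length (map rat_vec (map f B)))) W'"
  proof (rule bij_betw_transfer[OF W' A A' AW])
    show "bij_betw ((*\<^sub>v) (mat_of_cols p (map rat_vec B))) (carrier_vec (length (map rat_vec B))) W"
      using bij unfolding rat_mat_of_cols[OF Bp] by simp
  qed (use f Bp in auto)
  then have "polynomial_basis q W' (map f B)"
    using B'q unfolding polynomial_basis_iff_bij_betw[OF W'] rat_mat_of_cols[OF B'q] by simp
  moreover have "list_all2 R B (map f B)" using f by (simp add: list_all2_conv_all_nth)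
  ultimately show ?thesis by (rule that)
qed

lemma sort_map_add: "sort (map (\<lambda>e. e + d) xs) = map (\<lambda>e. e + d) (sort (xs :: nat list))"
  by (rule properties_for_sort) (auto simp: sorted_map intro: sorted_wrt_mono_rel[OF _ sorted_sort])

text \<open>
  All bases of \<open>W\<close> have the same number of vectors, so the lifts \<open>up\<close> and \<open>down\<close> change the degree
  sum of every basis by the same constant. Hence they carry minimal bases to minimal bases.
\<close>

lemma minimal_indices_transfer:
  fixes A A' :: "'a::field poly fract mat"
  assumes W: "vec_subspace p W" and W': "vec_subspace q W'"
    and A: "A \<in> carrier_mat r p" "inj_on ((*\<^sub>v) A) W"
    and A': "A' \<in> carrier_mat r q" "inj_on ((*\<^sub>v) A') W'"
    and AW: "(*\<^sub>v) A ` W = (*\<^sub>v) A' ` W'"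
    and up: "\<And>b. b \<in> carrier_vec p \<Longrightarrow> b \<noteq> 0\<^sub>v p \<Longrightarrow> rat_vec b \<in> W \<Longrightarrow>
      \<exists>b'. b' \<in> carrier_vec q \<and> rat_vec b' \<in> W' \<and> A *\<^sub>v rat_vec b = A' *\<^sub>v rat_vec b' \<and>
        vec_degree b' = vec_degree b + d"
    and down: "\<And>b'. b' \<in> carrier_vec q \<Longrightarrow> b' \<noteq> 0\<^sub>v q \<Longrightarrow> rat_vec b' \<in> W' \<Longrightarrow>
      \<exists>b. b \<in> carrier_vec p \<and> rat_vec b \<in> W \<and> A' *\<^sub>v rat_vec b' = A *\<^sub>v rat_vec b \<and>
        vec_degree b' = vec_degree b + d"
    and ds: "minimal_indices p W ds"
  shows "minimal_indices q W' (map (\<lambda>e. e + d) ds)"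
proof -
  obtain B where B: "minimal_basis p W B" and dsB: "ds = sort (map vec_degree B)"
    using ds unfolding minimal_indices_def by blast
  have pB: "polynomial_basis p W B" using B by (simp add: minimal_basis_def)
  obtain B' where B': "polynomial_basis q W' B'"
    and BB': "list_all2 (\<lambda>b b'. vec_degree b' = vec_degree b + d) B B'"
    using polynomial_basis_transfer[OF W W' A A' AW up pB] by blast
  have shift: "map vec_degree C' = map (\<lambda>e. e + d) (map vec_degree C)"
    if "list_all2 (\<lambda>b b'. vec_degree b' = vec_degree b + d) C C'" for C C' :: "'a poly vec list"
    using that by induction auto
  have sum: "sum_list (map (\<lambda>e. e + d) xs) = sum_list xs + length xs * d" for xs
    by (induction xs) auto
  have "minimal_basis q W' B'"
    unfolding minimal_basis_def
  proof (intro conjI allI impI B')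
    fix C' assume C': "polynomial_basis q W' C'"
    obtain C where C: "polynomial_basis p W C"
      and CC': "list_all2 (\<lambda>b' b. vec_degree b' = vec_degree b + d) C' C"
      using polynomial_basis_transfer[OF W' W A' A AW[symmetric] down C'] by blast
    have CC: "list_all2 (\<lambda>b b'. vec_degree b' = vec_degree b + d) C C'"
      using CC' by (simp add: list_all2_conv_all_nth)
    have "sum_list (map vec_degree B) \<le> sum_list (map vec_degree C)"
      using B C by (simp add: minimal_basis_def)
    moreover have "length B = length C" using polynomial_basis_length_unique[OF W pB C] .
    ultimately show "sum_list (map vec_degree B') \<le> sum_list (map vec_degree C')"
      unfolding shift[OF BB'] shift[OF CC] sum by simp
  qed
  then show ?thesis
    unfolding minimal_indices_def dsB shift[OF BB', symmetric] sort_map_add[symmetric]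
    using shift[OF BB'] by metis
qed

section \<open>Dual minimal bases\<close>

lemma minimal_basis_mat_column_basis:
  assumes "minimal_basis_mat K" and K: "K \<in> carrier_mat k q"
  shows "minimal_basis q ((*\<^sub>v) (rat_mat K\<^sup>T) ` carrier_vec k) (rows K)"
proof -
  have "rat_mat K \<in> carrier_mat k q" using K by simp
  from row_space_eq_range[OF this] show ?thesis
    using assms unfolding minimal_basis_mat_def by (simp add: map_mat_transpose)
qed

lemma range_subspace:
  assumes "A \<in> carrier_mat n k"
  shows "vec_subspace n ((*\<^sub>v) (A :: 'b::field mat) ` carrier_vec k)"
  using row_space_subspace[of "A\<^sup>T" k n] row_space_eq_range[of "A\<^sup>T" k n] assms by simp

lemma minimal_basis_mat_inj:
  assumes K: "minimal_basis_mat K" "K \<in> carrier_mat k q"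
  shows "inj_on ((*\<^sub>v) (rat_mat K\<^sup>T)) (carrier_vec k)"
proof -
  have "rat_mat K\<^sup>T \<in> carrier_mat q k" using K by simp
  then have "bij_betw (coords_to_vec q (rows K)) (carrier_vec (length (rows K)))
      ((*\<^sub>v) (rat_mat K\<^sup>T) ` carrier_vec k)"
    using minimal_basis_mat_column_basis[OF K] polynomial_basis_iff_bij_betw[OF range_subspace]
    unfolding minimal_basis_def by blast
  then show ?thesis using K(2) unfolding bij_betw_def mat_of_cols_rows[OF K(2)] by simp
qed

lemma minimal_basis_mat_shifts_degree:
  assumes K: "minimal_basis_mat K" "K \<in> carrier_mat k q"
    and deg: "\<forall>e \<in> set (row_degrees K). e = d"
  shows "shifts_degree d K\<^sup>T"
proof -
  have "rat_mat K\<^sup>T \<in> carrier_mat q k" using K by simp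
  from uniform_minimal_basis_shifts_degree[OF range_subspace[OF this] minimal_basis_mat_column_basis[OF K]]
  show ?thesis using deg unfolding mat_of_cols_rows[OF K(2)] row_degrees_def by auto
qed

lemma is_dual_of_dims:
  assumes K: "K \<in> carrier_mat k q" and N: "is_dual_of N K" and kq: "k \<le> q"
  shows "N \<in> carrier_mat (q - k) q"
  using assms unfolding is_dual_of_def dual_minimal_bases_def by (auto split: if_splits)

lemma dual_minimal_bases_kernel:
  assumes dual: "dual_minimal_bases K N" and K: "K \<in> carrier_mat k (k + n)" and N: "N \<in> carrier_mat n (k + n)"
  shows "mat_kernel (rat_mat K) = (*\<^sub>v) (rat_mat N\<^sup>T) ` carrier_vec n"
proof -
  have "rat_mat K * rat_mat N\<^sup>T = rat_mat (K * N\<^sup>T)"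
    using to_fract_hom.mat_hom_mult[of K k "k + n" "N\<^sup>T" n] K N by simp
  also have "\<dots> = 0\<^sub>m k n"
    using dual K N unfolding dual_minimal_bases_def by auto
  finally have "rat_mat K * (rat_mat N)\<^sup>T = 0\<^sub>m k n" by (simp add: map_mat_transpose)
  moreover have "inj_on ((*\<^sub>v) (rat_mat K)\<^sup>T) (carrier_vec k)" "inj_on ((*\<^sub>v) (rat_mat N)\<^sup>T) (carrier_vec n)"
    using dual minimal_basis_mat_inj[OF _ K] minimal_basis_mat_inj[OF _ N]
    unfolding dual_minimal_bases_def by (simp_all add: map_mat_transpose)
  ultimately show ?thesis
    using mat_kernel_eq_range_transpose[of "rat_mat K" k n "rat_mat N"] K N
    by (simp add: map_mat_transpose)
qed

lemma dual_minimal_bases_sym: "dual_minimal_bases K N \<Longrightarrow> dual_minimal_bases N K"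
proof -
  assume d: "dual_minimal_bases K N"
  then have dims: "dim_col N = dim_col K" "dim_row K + dim_row N = dim_col K"
    and KN: "K * N\<^sup>T = 0\<^sub>m (dim_row K) (dim_row N)"
    and min: "minimal_basis_mat K" "minimal_basis_mat N"
    by (simp_all only: dual_minimal_bases_def)
  have "N\<^sup>T \<in> carrier_mat (dim_col K) (dim_row N)" using dims by (intro carrier_matI) simp_all
  from transpose_mult[OF carrier_matI[OF refl refl] this]
  have "(K * N\<^sup>T)\<^sup>T = N * K\<^sup>T" unfolding transpose_transpose .
  moreover have "(K * N\<^sup>T)\<^sup>T = 0\<^sub>m (dim_row N) (dim_row K)" unfolding KN by simp
  ultimately show ?thesis unfolding dual_minimal_bases_def using dims min by simp
qed

text \<open>
  The case \<open>k = 0\<close> is separate because there the dual is the identity matrix by convention; it is not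
  a \<open>minimal_basis_mat\<close>, having as many rows as columns.
\<close>

lemma is_dual_of_kernel:
  assumes K: "K \<in> carrier_mat k (n + k)" and N: "is_dual_of N K"
  shows "N \<in> carrier_mat n (n + k)"
    and "mat_kernel (rat_mat K) = (*\<^sub>v) (rat_mat N\<^sup>T) ` carrier_vec n"
    and "mat_kernel (rat_mat N) = (*\<^sub>v) (rat_mat K\<^sup>T) ` carrier_vec k"
proof -
  show Nc: "N \<in> carrier_mat n (n + k)" using is_dual_of_dims[OF K N] by simp
  have "mat_kernel (rat_mat K) = (*\<^sub>v) (rat_mat N\<^sup>T) ` carrier_vec n \<and>
    mat_kernel (rat_mat N) = (*\<^sub>v) (rat_mat K\<^sup>T) ` carrier_vec k"
  proof (cases "k = 0")
    case True
    then have N1: "N = 1\<^sub>m n" using K N by (auto simp: is_dual_of_def)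
    have r1: "rat_mat (1\<^sub>m n) = 1\<^sub>m n" by (rule to_fract_hom.mat_hom_one)
    have "mat_kernel (rat_mat K) = carrier_vec n"
      using K True by (auto simp: mat_kernel_def)
    moreover have "(*\<^sub>v) (rat_mat N\<^sup>T) ` carrier_vec n = carrier_vec n"
      unfolding N1 by (auto simp: r1 image_iff)
    moreover have "mat_kernel (rat_mat N) = {0\<^sub>v n}"
      unfolding N1 by (auto simp: r1 mat_kernel_def)
    moreover have "(*\<^sub>v) (rat_mat K\<^sup>T) ` carrier_vec k = {0\<^sub>v n}"
    proof -
      have "rat_mat K\<^sup>T *\<^sub>v z = 0\<^sub>v n" if "z \<in> carrier_vec k" for z
        using K True that by (intro eq_vecI) (auto simp: scalar_prod_def)
      moreover have "carrier_vec k \<noteq> ({} :: 'a poly fract vec set)"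
        using zero_carrier_vec by blast
      ultimately show ?thesis by auto
    qed
    ultimately show ?thesis by simp
  next
    case False
    then have d: "dual_minimal_bases K N" using K N by (auto simp: is_dual_of_def)
    show ?thesis
      using dual_minimal_bases_kernel[OF d, of k n] dual_minimal_bases_kernel[OF dual_minimal_bases_sym[OF d], of n k]
        K Nc by (simp add: add.commute)
  qed
  then show "mat_kernel (rat_mat K) = (*\<^sub>v) (rat_mat N\<^sup>T) ` carrier_vec n"
    and "mat_kernel (rat_mat N) = (*\<^sub>v) (rat_mat K\<^sup>T) ` carrier_vec k" by auto
qed

lemma mat_degree_uniform:
  assumes A: "A \<in> carrier_mat n q" "n > 0" and deg: "\<forall>e \<in> set (row_degrees A). e = d"
  shows "mat_degree A = d"
proof -
  have row: "vec_degree (row A i) = d" if "i < n" for i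
  proof -
    have "row A i \<in> set (rows A)" using that A by (auto simp: rows_def)
    then show ?thesis using deg unfolding row_degrees_def by auto
  qed
  have le_iff: "mat_degree A \<le> e \<longleftrightarrow> (\<forall>i < n. vec_degree (row A i) \<le> e)" for e
    unfolding mat_degree_le_iff vec_degree_le_iff using A by auto
  have "mat_degree A \<le> d" using le_iff row by simp
  moreover have "d \<le> mat_degree A" using le_iff[of "mat_degree A"] row A(2) by auto
  ultimately show ?thesis by simp
qed

text \<open>
  Each vector of \<open>C\<close> has a nonzero polynomial coordinate vector with respect to \<open>B\<close>, so by degree
  shifting its degree is at least \<open>d\<close>. As \<open>C\<close> has as many vectors as \<open>B\<close> and no larger a degree sum,
  none of its degrees exceeds \<open>d\<close>.
\<close>

lemma uniform_degrees_of_minimal_basis: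
  assumes W: "vec_subspace q W"
    and B: "minimal_basis q W B" "\<And>b. b \<in> set B \<Longrightarrow> vec_degree b = d"
    and C: "minimal_basis q W C" and c: "c \<in> set C"
  shows "vec_degree c = d"
proof -
  let ?M = "mat_of_cols q B"
  have pB: "polynomial_basis q W B" and pC: "polynomial_basis q W C"
    using B(1) C by (simp_all add: minimal_basis_def)
  note shift = uniform_minimal_basis_shifts_degree[OF W B]
  have bij: "bij_betw (coords_to_vec q B) (carrier_vec (length B)) W"
    using pB unfolding polynomial_basis_iff_bij_betw[OF W] by simp
  have ge: "d \<le> vec_degree c" if c: "c \<in> set C" for c
  proof -
    obtain j where j: "j < length C" "c = C ! j" using c by (metis in_set_conv_nth)
    have Cq: "set C \<subseteq> carrier_vec q"
      and bijC: "bij_betw (coords_to_vec q C) (carrier_vec (length C)) W"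
      using pC unfolding polynomial_basis_iff_bij_betw[OF W] by auto
    have cq: "c \<in> carrier_vec q" using Cq c by auto
    have col: "coords_to_vec q C (unit_vec (length C) j) = rat_vec c"
      using j cq by (intro eq_vecI) (auto simp: mat_of_cols_def)
    then have "rat_vec c \<in> W" using bijC unfolding bij_betw_def
      by (metis image_eqI unit_vec_carrier)
    then obtain z where z: "z \<in> carrier_vec (length B)" "coords_to_vec q B z = rat_vec c"
      using bij unfolding bij_betw_def by (metis imageE)
    then obtain w where w: "w \<in> carrier_vec (length B)" "z = rat_vec w"
      using shift unfolding shifts_degree_def by auto
    have "rat_vec (?M *\<^sub>v w) = rat_vec c"
      using z w rat_vec_mult_mat_vec[of w ?M] by simp
    then have cw: "c = ?M *\<^sub>v w" by (metis to_fract_hom.vec_hom_inj)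
    have "w \<noteq> 0\<^sub>v (length B)"
    proof
      assume "w = 0\<^sub>v (length B)"
      then have "c = 0\<^sub>v q" unfolding cw by (intro eq_vecI) auto
      then have "coords_to_vec q C (unit_vec (length C) j) = coords_to_vec q C (0\<^sub>v (length C))"
        unfolding col by (intro eq_vecI) auto
      then have "unit_vec (length C) j = (0\<^sub>v (length C) :: 'a poly fract vec)"
        using bijC unfolding bij_betw_def inj_on_def by (metis unit_vec_carrier zero_carrier_vec)
      then show False using j by simp
    qed
    then have "vec_degree c = d + vec_degree w"
      using shift w unfolding cw shifts_degree_def by simp
    then show ?thesis by simp
  qed
  have "sum_list (map vec_degree C) \<le> sum_list (map vec_degree B)"
    using C pB unfolding minimal_basis_def by blast
  also have "map vec_degree B = map (\<lambda>_. d) B" using B(2) by simp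
  also have "sum_list (map (\<lambda>_. d) B) = sum_list (map (\<lambda>_. d) C)"
    using polynomial_basis_length_unique[OF W pB pC] by (simp add: sum_list_triv)
  finally have le: "(\<Sum>c\<leftarrow>C. vec_degree c) \<le> (\<Sum>c\<leftarrow>C. d)" .
  have "(\<Sum>c\<leftarrow>xs. d) < (\<Sum>c\<leftarrow>xs. vec_degree c)"
    if "set xs \<subseteq> set C" "x \<in> set xs" "vec_degree x \<noteq> d" for x xs
    using that
  proof (induction xs)
    case (Cons y ys)
    have mono: "(\<Sum>c\<leftarrow>ys. d) \<le> (\<Sum>c\<leftarrow>ys. vec_degree c)"
      using Cons.prems ge by (intro sum_list_mono) auto
    have y: "d \<le> vec_degree y" using Cons.prems ge by auto
    show ?case
    proof (cases "x = y")
      case True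
      then show ?thesis using mono y Cons.prems by simp
    next
      case False
      then show ?thesis using Cons y by simp
    qed
  qed simp
  from this[OF order_refl c] le show ?thesis by fastforce
qed

text \<open>
  Unless \<open>K\<close> has no rows, the rows of \<open>N\<close> and those of \<open>N'\<close> are minimal bases of the same space, the
  kernel of \<open>K\<close>, so the equal row degrees of \<open>N'\<close> are inherited by \<open>N\<close>.
\<close>

lemma is_dual_of_shifts_degree:
  assumes K: "K \<in> carrier_mat k (n + k)" "n > 0"
    and N: "is_dual_of N K" and N': "is_dual_of N' K" "\<forall>e \<in> set (row_degrees N'). e = d"
  shows "shifts_degree (mat_degree N) N\<^sup>T"
proof (cases "k = 0")
  case True
  then have N1: "N = 1\<^sub>m n" using K N by (auto simp: is_dual_of_def)
  have "mat_degree N \<le> 0" unfolding N1 mat_degree_le_iff by (auto simp: one_mat_def)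
  then show ?thesis using shifts_degree_one[of n] unfolding N1 by simp
next
  case False
  have Nc: "N \<in> carrier_mat n (n + k)" and N'c: "N' \<in> carrier_mat n (n + k)"
    using is_dual_of_kernel(1)[OF K(1)] N N' by auto
  let ?W = "mat_kernel (rat_mat K)"
  have W: "vec_subspace (n + k) ?W" using K by (intro mat_kernel_subspace[of _ k]) simp
  have min: "minimal_basis_mat N" "minimal_basis_mat N'"
    using False K N N' by (auto simp: is_dual_of_def dual_minimal_bases_def)
  have "vec_degree b = d" if "b \<in> set (rows N)" for b
  proof (rule uniform_degrees_of_minimal_basis[OF W _ _ _ that])
    show "minimal_basis (n + k) ?W (rows N')"
      using minimal_basis_mat_column_basis[OF min(2) N'c]
      unfolding is_dual_of_kernel(2)[OF K(1) N'(1)] .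
    show "minimal_basis (n + k) ?W (rows N)"
      using minimal_basis_mat_column_basis[OF min(1) Nc]
      unfolding is_dual_of_kernel(2)[OF K(1) N] .
    show "vec_degree b = d" if "b \<in> set (rows N')" for b
      using N'(2) that by (auto simp: row_degrees_def)
  qed
  then have deg: "\<forall>e \<in> set (row_degrees N). e = d" by (simp add: row_degrees_def)
  show ?thesis
    using minimal_basis_mat_shifts_degree[OF min(1) Nc deg] mat_degree_uniform[OF Nc K(2) deg] by simp
qed

section \<open>Null space of the block matrix\<close>

lemma mem_mat_kernel_iff:
  "A \<in> carrier_mat nr nc \<Longrightarrow> v \<in> mat_kernel A \<longleftrightarrow> v \<in> carrier_vec nc \<and> A *\<^sub>v v = 0\<^sub>v nr"
  unfolding mat_kernel_def by auto

text \<open>The matrix of the projection \<open>(x, y) \<mapsto> x\<close>.\<close>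

definition first_coords :: "nat \<Rightarrow> nat \<Rightarrow> 'b::field mat" where
  "first_coords r k = mat r (r + k) (\<lambda>(i, j). if i = j then 1 else 0)"

lemma first_coords_carrier: "first_coords r k \<in> carrier_mat r (r + k)"
  by (simp add: first_coords_def)

lemma first_coords_append:
  assumes "x \<in> carrier_vec r" "y \<in> carrier_vec k"
  shows "first_coords r k *\<^sub>v (x @\<^sub>v y) = x"
proof (rule eq_vecI)
  fix i assume "i < dim_vec x"
  then have i: "i < r" using assms by simp
  have "(first_coords r k *\<^sub>v (x @\<^sub>v y)) $ i =
      (\<Sum>j = 0..<r + k. (if i = j then 1 else 0) * (x @\<^sub>v y) $ j)"
    using i assms unfolding first_coords_def by (auto simp: scalar_prod_def intro!: sum.cong)
  also have "\<dots> = (\<Sum>j = 0..<r + k. if i = j then (x @\<^sub>v y) $ j else 0)"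
    by (intro sum.cong) auto
  also have "\<dots> = x $ i" using i assms by simp
  finally show "(first_coords r k *\<^sub>v (x @\<^sub>v y)) $ i = x $ i" .
qed (use assms in \<open>simp add: first_coords_def\<close>)

lemma append_vec_mem_kernel_block_matrix:
  assumes M: "M \<in> carrier_mat a r" and K1: "K1 \<in> carrier_mat b r" and K2: "K2 \<in> carrier_mat k a"
    and x: "x \<in> carrier_vec r" and y: "y \<in> carrier_vec k"
  shows "x @\<^sub>v y \<in> mat_kernel (rat_mat (block_matrix M K1 K2)) \<longleftrightarrow>
    rat_mat K1 *\<^sub>v x = 0\<^sub>v b \<and> rat_mat M *\<^sub>v x + rat_mat K2\<^sup>T *\<^sub>v y = 0\<^sub>v a"
proof -
  let ?L = "four_block_mat (rat_mat M) (rat_mat K2\<^sup>T) (rat_mat K1) (0\<^sub>m b k)"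
  have L: "rat_mat (block_matrix M K1 K2) = ?L"
    unfolding block_matrix_def
    using M K1 K2 by (subst map_four_block_mat[of _ a r _ k _ b]) auto
  have Lc: "?L \<in> carrier_mat (a + b) (r + k)" using M K1 K2 by auto
  have "?L *\<^sub>v (x @\<^sub>v y) =
      (rat_mat M *\<^sub>v x + rat_mat K2\<^sup>T *\<^sub>v y) @\<^sub>v (rat_mat K1 *\<^sub>v x + 0\<^sub>m b k *\<^sub>v y)"
    using M K1 K2 x y by (intro four_block_mat_mult_vec[of _ a r _ k _ b]) auto
  also have "rat_mat K1 *\<^sub>v x + 0\<^sub>m b k *\<^sub>v y = rat_mat K1 *\<^sub>v x"
    using K1 x y by (intro eq_vecI) auto
  also have "0\<^sub>v (a + b) = (0\<^sub>v a :: 'a poly fract vec) @\<^sub>v 0\<^sub>v b" by (intro eq_vecI) auto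
  moreover have "rat_mat M *\<^sub>v x + rat_mat K2\<^sup>T *\<^sub>v y \<in> carrier_vec a"
    using M K2 x y by (intro add_carrier_vec) auto
  ultimately show ?thesis
    unfolding L mem_mat_kernel_iff[OF Lc] using x y
    by (auto simp: append_vec_eq[of _ a])
qed

lemma rat_vec_append: "rat_vec (x @\<^sub>v y) = rat_vec x @\<^sub>v rat_vec y"
  by (intro eq_vecI) auto

lemma add_eq_0_iff_vec:
  assumes "x \<in> carrier_vec n" "y \<in> carrier_vec n"
  shows "x + y = 0\<^sub>v n \<longleftrightarrow> y = - (x :: 'b::ab_group_add vec)"
  using assms by (auto simp: vec_eq_iff eq_neg_iff_add_eq_0 add.commute)

text \<open>
  The two null spaces are matched by \<open>z \<mapsto> (N1\<^sup>T z, y)\<close>, where \<open>y\<close> is determined by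
  \<open>K2\<^sup>T y = - M N1\<^sup>T z\<close>. The fact \<open>degree\<close> below is where the grade of \<open>M\<close> meets the common row degree
  of \<open>K2\<close>: multiplication by \<open>M\<close> adds at most \<open>l\<close> to a degree and \<open>K2\<^sup>T\<close> adds exactly \<open>l\<close>, so the degree
  of \<open>y\<close> cannot exceed that of \<open>N1\<^sup>T z\<close>.
\<close>

lemma right_minimal_indices_block_matrix:
  fixes M :: "'a::field poly mat"
  assumes M: "M \<in> carrier_mat (m + m2) (n + m1)" "has_grade M l"
    and K1: "K1 \<in> carrier_mat m1 (n + m1)" and K2: "K2 \<in> carrier_mat m2 (m + m2)"
    and N1: "N1 \<in> carrier_mat n (n + m1)" and N2: "N2 \<in> carrier_mat m (m + m2)"
    and kerK1: "mat_kernel (rat_mat K1) = (*\<^sub>v) (rat_mat N1\<^sup>T) ` carrier_vec n"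
    and kerN2: "mat_kernel (rat_mat N2) = (*\<^sub>v) (rat_mat K2\<^sup>T) ` carrier_vec m2"
    and shN1: "shifts_degree d N1\<^sup>T" and shK2: "shifts_degree l K2\<^sup>T"
    and \<epsilon>: "right_minimal_indices (N2 * M * N1\<^sup>T) \<epsilon>"
  shows "right_minimal_indices (block_matrix M K1 K2) (map (\<lambda>e. e + d) \<epsilon>)"
proof -
  let ?r = "n + m1" and ?a = "m + m2"
  let ?Q = "N2 * M * N1\<^sup>T" and ?L = "block_matrix M K1 K2"
  let ?W = "mat_kernel (rat_mat ?Q)" and ?W' = "mat_kernel (rat_mat ?L)"
  let ?A = "rat_mat N1\<^sup>T" and ?A' = "first_coords ?r m2 :: 'a poly fract mat"
  have Q: "?Q \<in> carrier_mat m n" using M N1 N2 by simp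
  have L: "?L \<in> carrier_mat (?a + m1) (?r + m2)"
    unfolding block_matrix_def using M K1 K2 by auto
  have A: "?A \<in> carrier_mat ?r n" and rM: "rat_mat M \<in> carrier_mat ?a ?r"
    and rK2: "rat_mat K2\<^sup>T \<in> carrier_mat ?a m2" and rN2: "rat_mat N2 \<in> carrier_mat m ?a"
    and rK1: "rat_mat K1 \<in> carrier_mat m1 ?r"
    using M N1 N2 K1 K2 by simp_all
  have injA: "inj_on ((*\<^sub>v) ?A) (carrier_vec n)"
    using shN1 N1 unfolding shifts_degree_def by simp
  have injK2: "inj_on ((*\<^sub>v) (rat_mat K2\<^sup>T)) (carrier_vec m2)"
    using shK2 K2 unfolding shifts_degree_def by simp
  have mult_carrier: "?A *\<^sub>v z \<in> carrier_vec ?r" "rat_mat M *\<^sub>v x \<in> carrier_vec ?a"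
    "rat_mat K2\<^sup>T *\<^sub>v y \<in> carrier_vec ?a" for x y z
    using A rM rK2 by (auto intro: carrier_vecI)
  have K2_uminus: "rat_mat K2\<^sup>T *\<^sub>v (- y) = - (rat_mat K2\<^sup>T *\<^sub>v y)"
    if "y \<in> carrier_vec m2" for y
    using that rK2 by (intro eq_vecI) auto
  have W: "z \<in> ?W \<longleftrightarrow> rat_mat N2 *\<^sub>v (rat_mat M *\<^sub>v (?A *\<^sub>v z)) = 0\<^sub>v m"
    if z: "z \<in> carrier_vec n" for z
  proof -
    have "rat_mat ?Q = rat_mat N2 * rat_mat M * ?A"
      using M N1 N2 to_fract_hom.mat_hom_mult[of N2 m ?a M ?r]
        to_fract_hom.mat_hom_mult[of "N2 * M" m ?r "N1\<^sup>T" n] by simp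
    then have "rat_mat ?Q *\<^sub>v z = rat_mat N2 *\<^sub>v (rat_mat M *\<^sub>v (?A *\<^sub>v z))"
      using z assoc_mult_mat_vec[OF mult_carrier_mat[OF rN2 rM] A z]
        assoc_mult_mat_vec[OF rN2 rM, of "?A *\<^sub>v z"] mult_carrier by simp
    then show ?thesis
      using z Q by (simp add: mem_mat_kernel_iff[of _ m n])
  qed
  have W': "x @\<^sub>v y \<in> ?W' \<longleftrightarrow>
      x \<in> mat_kernel (rat_mat K1) \<and> rat_mat K2\<^sup>T *\<^sub>v y = - (rat_mat M *\<^sub>v x)"
    if "x \<in> carrier_vec ?r" "y \<in> carrier_vec m2" for x y
    unfolding append_vec_mem_kernel_block_matrix[OF M(1) K1 K2 that]
      mem_mat_kernel_iff[OF rK1] add_eq_0_iff_vec[OF mult_carrier(2,3)]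
    using that by simp
  have split: "\<exists>x y. x \<in> carrier_vec ?r \<and> y \<in> carrier_vec m2 \<and> v = x @\<^sub>v y"
    if "v \<in> carrier_vec (?r + m2)" for v :: "'c vec"
    using that by (intro exI[of _ "vec_first v ?r"] exI[of _ "vec_last v m2"]) simp
  have W'c: "?W' \<subseteq> carrier_vec (?r + m2)" using L by (intro mat_kernel_carrier) simp
  have to_W': "\<exists>y \<in> carrier_vec m2. (?A *\<^sub>v z) @\<^sub>v y \<in> ?W'" if z: "z \<in> ?W" "z \<in> carrier_vec n" for z
  proof -
    let ?x = "?A *\<^sub>v z"
    have "rat_mat M *\<^sub>v ?x \<in> mat_kernel (rat_mat N2)"
      using W[OF z(2)] z(1) mult_carrier by (simp add: mem_mat_kernel_iff[OF rN2])
    then obtain y where y: "y \<in> carrier_vec m2" "rat_mat M *\<^sub>v ?x = rat_mat K2\<^sup>T *\<^sub>v y"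
      unfolding kerN2 by auto
    \<comment> \<open>The sign comes from \<open>M x + K2\<^sup>T y = 0\<close> in the first block row.\<close>
    have "?x @\<^sub>v (- y) \<in> ?W'"
      using W'[of ?x "- y"] mult_carrier y z kerK1 K2_uminus[OF y(1)] by simp
    then show ?thesis using y(1) by (intro bexI[of _ "- y"]) simp_all
  qed
  have from_W': "\<exists>z \<in> carrier_vec n. z \<in> ?W \<and> x = ?A *\<^sub>v z"
    if xy: "x @\<^sub>v y \<in> ?W'" "x \<in> carrier_vec ?r" "y \<in> carrier_vec m2" for x y
  proof -
    obtain z where z: "z \<in> carrier_vec n" "x = ?A *\<^sub>v z"
      using W'[OF xy(2,3)] xy(1) unfolding kerK1 by auto
    have "rat_mat K2\<^sup>T *\<^sub>v (- y) = rat_mat M *\<^sub>v x"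
      using W'[OF xy(2,3)] xy(1) K2_uminus[OF xy(3)] by simp
    then have "rat_mat M *\<^sub>v x \<in> mat_kernel (rat_mat N2)"
      unfolding kerN2 using xy(3) by (metis image_eqI uminus_carrier_vec)
    then show ?thesis using z W[OF z(1)] by (auto simp: mem_mat_kernel_iff[OF rN2])
  qed
  have degree: "vec_degree (x @\<^sub>v y) = vec_degree w + d"
    if w: "w \<in> carrier_vec n" "w \<noteq> 0\<^sub>v n" and x: "x = N1\<^sup>T *\<^sub>v w"
      and y: "y \<in> carrier_vec m2" "K2\<^sup>T *\<^sub>v y = - (M *\<^sub>v x)" for w x y
  proof -
    have dx: "vec_degree x = d + vec_degree w"
      using shN1 w N1 unfolding shifts_degree_def x by simp
    have "vec_degree y \<le> vec_degree x"
    proof (cases "y = 0\<^sub>v m2")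
      case True
      then have "vec_degree y \<le> 0" unfolding vec_degree_le_iff by simp
      then show ?thesis by simp
    next
      case False
      then have "l + vec_degree y = vec_degree (K2\<^sup>T *\<^sub>v y)"
        using shK2 y(1) K2 unfolding shifts_degree_def by simp
      also have "\<dots> = vec_degree (M *\<^sub>v x)" unfolding y(2) by (rule vec_degree_uminus)
      also have "\<dots> \<le> l + vec_degree x"
        using M N1 w x has_grade_degree_le[OF M(2)]
        by (intro vec_degree_mult_mat_vec_le) (auto intro: carrier_vecI)
      finally show ?thesis by simp
    qed
    then show ?thesis unfolding vec_degree_append using dx by simp
  qed
  have poly_eq: "K2\<^sup>T *\<^sub>v y = - (M *\<^sub>v x)"
    if "rat_vec x @\<^sub>v rat_vec y \<in> ?W'" "x \<in> carrier_vec ?r" "y \<in> carrier_vec m2" for x y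
  proof -
    have "rat_mat K2\<^sup>T *\<^sub>v rat_vec y = - (rat_mat M *\<^sub>v rat_vec x)"
      using W'[of "rat_vec x" "rat_vec y"] that by simp
    then have "rat_vec (K2\<^sup>T *\<^sub>v y) = - rat_vec (M *\<^sub>v x)"
      using rat_vec_mult_mat_vec[of y "K2\<^sup>T"] rat_vec_mult_mat_vec[of x M] that K2 M by simp
    also have "\<dots> = rat_vec (- (M *\<^sub>v x))" by (intro eq_vecI) auto
    finally show ?thesis by (rule to_fract_hom.vec_hom_inj)
  qed
  have "minimal_indices (?r + m2) ?W' (map (\<lambda>e. e + d) \<epsilon>)"
  proof (rule minimal_indices_transfer[where p = n and W = ?W and r = ?r and A = ?A and A' = ?A'])
    show "vec_subspace n ?W" using Q by (intro mat_kernel_subspace[of _ m]) simp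
    show "vec_subspace (?r + m2) ?W'" using L by (intro mat_kernel_subspace[of _ "?a + m1"]) simp
    show "?A \<in> carrier_mat ?r n" by (rule A)
    have Wc: "?W \<subseteq> carrier_vec n" using Q by (intro mat_kernel_carrier) simp
    show "inj_on ((*\<^sub>v) ?A) ?W" using injA Wc by (rule inj_on_subset)
    show "?A' \<in> carrier_mat ?r (?r + m2)" by (rule first_coords_carrier)
    show "inj_on ((*\<^sub>v) ?A') ?W'"
    proof (rule inj_onI)
      fix v v' assume v: "v \<in> ?W'" "v' \<in> ?W'" and eq: "?A' *\<^sub>v v = ?A' *\<^sub>v v'"
      obtain x y where xy: "x \<in> carrier_vec ?r" "y \<in> carrier_vec m2" "v = x @\<^sub>v y"
        using split v(1) W'c by blast
      obtain x' y' where xy': "x' \<in> carrier_vec ?r" "y' \<in> carrier_vec m2" "v' = x' @\<^sub>v y'"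
        using split v(2) W'c by blast
      have x: "x' = x" using eq xy xy' by (simp add: first_coords_append)
      have "rat_mat K2\<^sup>T *\<^sub>v y = rat_mat K2\<^sup>T *\<^sub>v y'"
        using v W'[OF xy(1,2)] W'[OF xy'(1,2)] unfolding xy(3) xy'(3) x by simp
      then have "y = y'" using injK2 xy xy' unfolding inj_on_def by blast
      then show "v = v'" unfolding xy(3) xy'(3) x by simp
    qed
    show "(*\<^sub>v) ?A ` ?W = (*\<^sub>v) ?A' ` ?W'"
    proof (intro equalityI subsetI)
      fix x assume "x \<in> (*\<^sub>v) ?A ` ?W"
      then obtain z where z: "z \<in> ?W" "z \<in> carrier_vec n" "x = ?A *\<^sub>v z" using Wc by blast
      with to_W' obtain y where "y \<in> carrier_vec m2" "x @\<^sub>v y \<in> ?W'" by blast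
      then show "x \<in> (*\<^sub>v) ?A' ` ?W'"
        using first_coords_append[of x ?r y m2] mult_carrier(1)[of z] z by (metis image_eqI)
    next
      fix x assume "x \<in> (*\<^sub>v) ?A' ` ?W'"
      then obtain v where v: "v \<in> ?W'" "x = ?A' *\<^sub>v v" by blast
      obtain x' y where xy: "x' \<in> carrier_vec ?r" "y \<in> carrier_vec m2" "v = x' @\<^sub>v y"
        using split v(1) W'c by blast
      with v have x: "x = x'" by (simp add: first_coords_append)
      from v(1) have "x' @\<^sub>v y \<in> ?W'" unfolding xy(3) .
      from from_W'[OF this xy(1,2)] show "x \<in> (*\<^sub>v) ?A ` ?W" unfolding x by auto
    qed
    show "minimal_indices n ?W \<epsilon>"
      using \<epsilon> unfolding right_minimal_indices_def carrier_matD(2)[OF Q] .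
  next
    fix b :: "'a poly vec" assume b: "b \<in> carrier_vec n" "b \<noteq> 0\<^sub>v n" "rat_vec b \<in> ?W"
    define x where "x = N1\<^sup>T *\<^sub>v b"
    have x: "x \<in> carrier_vec ?r" unfolding x_def using N1 by (intro carrier_vecI) simp
    have Ab: "?A *\<^sub>v rat_vec b = rat_vec x"
      unfolding x_def using N1 b by (intro rat_vec_mult_mat_vec) simp
    obtain y where y: "y \<in> carrier_vec m2" "rat_vec x @\<^sub>v y \<in> ?W'"
      using to_W'[OF b(3)] b(1) unfolding Ab by auto
    have "rat_mat K2\<^sup>T *\<^sub>v y = - (rat_mat M *\<^sub>v rat_vec x)" using W'[of "rat_vec x" y] x y by simp
    also have "\<dots> = - rat_vec (M *\<^sub>v x)"
      using M x by (subst rat_vec_mult_mat_vec) auto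
    also have "\<dots> = rat_vec (- (M *\<^sub>v x))" by (intro eq_vecI) auto
    finally obtain y' where y': "y' \<in> carrier_vec m2" "y = rat_vec y'"
      using shK2 y K2 unfolding shifts_degree_def by auto
    have "vec_degree (x @\<^sub>v y') = vec_degree b + d"
      using degree[OF b(1,2) x_def y'(1)] poly_eq[of x y'] x y y' by simp
    moreover have "?A' *\<^sub>v rat_vec (x @\<^sub>v y') = rat_vec x"
      unfolding rat_vec_append using x y' by (intro first_coords_append) auto
    ultimately show "\<exists>b'. b' \<in> carrier_vec (?r + m2) \<and> rat_vec b' \<in> ?W' \<and>
        ?A *\<^sub>v rat_vec b = ?A' *\<^sub>v rat_vec b' \<and> vec_degree b' = vec_degree b + d"
      using x y y' unfolding Ab by (intro exI[of _ "x @\<^sub>v y'"]) (auto simp: rat_vec_append)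
  next
    fix b' :: "'a poly vec" assume b': "b' \<in> carrier_vec (?r + m2)" "b' \<noteq> 0\<^sub>v (?r + m2)" "rat_vec b' \<in> ?W'"
    obtain x y where xy: "x \<in> carrier_vec ?r" "y \<in> carrier_vec m2" "b' = x @\<^sub>v y"
      using split b'(1) by blast
    have mem: "rat_vec x @\<^sub>v rat_vec y \<in> ?W'" using b'(3) unfolding xy(3) rat_vec_append .
    obtain z where z: "z \<in> carrier_vec n" "z \<in> ?W" "rat_vec x = ?A *\<^sub>v z"
      using from_W'[OF mem] xy by auto
    obtain w where w: "w \<in> carrier_vec n" "z = rat_vec w"
      using shN1 z N1 unfolding shifts_degree_def by (metis carrier_matD(1) index_transpose_mat(3))
    have "rat_vec x = rat_vec (N1\<^sup>T *\<^sub>v w)"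
      unfolding z(3) w(2) using N1 w by (intro rat_vec_mult_mat_vec) simp
    then have x: "x = N1\<^sup>T *\<^sub>v w" by (rule to_fract_hom.vec_hom_inj)
    have K2y: "K2\<^sup>T *\<^sub>v y = - (M *\<^sub>v x)" using poly_eq[OF mem xy(1,2)] .
    have "w \<noteq> 0\<^sub>v n"
    proof
      assume "w = 0\<^sub>v n"
      then have x0: "x = 0\<^sub>v ?r" unfolding x using N1 by (intro eq_vecI) auto
      have "rat_mat K2\<^sup>T *\<^sub>v rat_vec y = rat_mat K2\<^sup>T *\<^sub>v 0\<^sub>v m2"
      proof -
        have "K2\<^sup>T *\<^sub>v y = 0\<^sub>v ?a" unfolding K2y x0 using M by (intro eq_vecI) auto
        then have "rat_mat K2\<^sup>T *\<^sub>v rat_vec y = rat_vec (0\<^sub>v ?a)"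
          using rat_vec_mult_mat_vec[of y "K2\<^sup>T"] xy K2 by simp
        also have "\<dots> = rat_mat K2\<^sup>T *\<^sub>v 0\<^sub>v m2" using K2 by (intro eq_vecI) auto
        finally show ?thesis .
      qed
      from inj_onD[OF injK2 this] have "rat_vec y = 0\<^sub>v m2" using xy(2) by simp
      then have "y = 0\<^sub>v m2" by simp
      then have "b' = 0\<^sub>v (?r + m2)" unfolding xy(3) x0 by (intro eq_vecI) auto
      with b'(2) show False ..
    qed
    then have "vec_degree b' = vec_degree w + d"
      unfolding xy(3) using degree[OF w(1) _ x xy(2) K2y] by simp
    moreover have "?A' *\<^sub>v rat_vec b' = rat_vec x"
      unfolding rat_vec_append xy(3) using xy by (intro first_coords_append) auto
    ultimately show "\<exists>b. b \<in> carrier_vec n \<and> rat_vec b \<in> ?W \<and>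
        ?A' *\<^sub>v rat_vec b' = ?A *\<^sub>v rat_vec b \<and> vec_degree b' = vec_degree b + d"
      using w z by (intro exI[of _ w]) simp
  qed
  then show ?thesis unfolding right_minimal_indices_def carrier_matD(2)[OF L] .
qed

section \<open>Left null spaces by transposition\<close>

lemma left_minimal_indices_transpose: "left_minimal_indices P = right_minimal_indices P\<^sup>T"
proof -
  have "mat_of_row y * rat_mat P = 0\<^sub>m 1 (dim_col P) \<longleftrightarrow> rat_mat P\<^sup>T *\<^sub>v y = 0\<^sub>v (dim_col P)"
    if "y \<in> carrier_vec (dim_row P)" for y
  proof -
    have "(mat_of_row y * rat_mat P) $$ (0, j) = (rat_mat P\<^sup>T *\<^sub>v y) $ j" if "j < dim_col P" for j
      using that \<open>y \<in> carrier_vec (dim_row P)\<close>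
      by (simp add: map_mat_transpose[symmetric] comm_scalar_prod[of _ "dim_row P"])
    then show ?thesis by (auto simp: mat_eq_iff vec_eq_iff)
  qed
  then have "left_null_space P = mat_kernel (rat_mat P\<^sup>T)"
    unfolding left_null_space_def mat_kernel_def by auto
  then show ?thesis unfolding left_minimal_indices_def right_minimal_indices_def by simp
qed

lemma has_grade_transpose:
  assumes "has_grade A g"
  shows "has_grade A\<^sup>T g"
proof -
  obtain P :: "nat \<Rightarrow> 'a mat" where P: "\<forall>i\<le>g. P i \<in> carrier_mat (dim_row A) (dim_col A)"
    and A: "A = mat (dim_row A) (dim_col A) (\<lambda>(r, c). \<Sum>i\<le>g. monom (P i $$ (r, c)) i)"
    using assms unfolding has_grade_def by blast
  have entry: "A $$ (r, c) = (\<Sum>i\<le>g. monom (P i $$ (r, c)) i)" if "r < dim_row A" "c < dim_col A" for r c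
    by (subst A) (use that in simp)
  show ?thesis
    unfolding has_grade_def
  proof (intro exI[of _ "\<lambda>i. (P i)\<^sup>T"] conjI)
    show "\<forall>i\<le>g. (P i)\<^sup>T \<in> carrier_mat (dim_row A\<^sup>T) (dim_col A\<^sup>T)" using P by auto
    show "A\<^sup>T = mat (dim_row A\<^sup>T) (dim_col A\<^sup>T) (\<lambda>(r, c). \<Sum>i\<le>g. monom ((P i)\<^sup>T $$ (r, c)) i)"
    proof (rule eq_matI, goal_cases)
      case (1 i j)
      have "(\<Sum>e\<le>g. monom ((P e)\<^sup>T $$ (i, j)) e) = (\<Sum>e\<le>g. monom (P e $$ (j, i)) e)"
      proof (rule sum.cong[OF refl])
        fix e assume "e \<in> {..g}"
        then have "P e \<in> carrier_mat (dim_row A) (dim_col A)" using P by simp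
        then show "monom ((P e)\<^sup>T $$ (i, j)) e = monom (P e $$ (j, i)) e" using 1 by simp
      qed
      then show ?case using 1 entry by simp
    qed simp_all
  qed
qed

theorem theorem6p2:
  fixes M K1 K2 N1 N2 L Q :: "'a::field poly mat" and l m n m1 m2 :: nat
  assumes "strong_block_minimal_bases l m n m1 m2 M K1 K2"
    and "L = block_matrix M K1 K2"
    and "is_dual_of N1 K1"
    and "is_dual_of N2 K2"
    and "Q = N2 * M * N1\<^sup>T"
  shows "(\<forall>\<epsilon>. right_minimal_indices Q \<epsilon> \<longrightarrow>
            right_minimal_indices L (map (\<lambda>e. e + mat_degree N1) \<epsilon>)) \<and>
         (\<forall>\<eta>. left_minimal_indices Q \<eta> \<longrightarrow>
            left_minimal_indices L (map (\<lambda>e. e + mat_degree N2) \<eta>))"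
proof -
  note S = assms(1)[unfolded strong_block_minimal_bases_def]
  have M: "M \<in> carrier_mat (m + m2) (n + m1)" "has_grade M l"
    and K1: "K1 \<in> carrier_mat m1 (n + m1)" "minimal_basis_mat K1" "\<forall>e \<in> set (row_degrees K1). e = l"
    and K2: "K2 \<in> carrier_mat m2 (m + m2)" "minimal_basis_mat K2" "\<forall>e \<in> set (row_degrees K2). e = l"
    using S by blast+
  obtain N1' d1 N2' d2 where N1': "is_dual_of N1' K1" "\<forall>e \<in> set (row_degrees N1'). e = d1"
    and N2': "is_dual_of N2' K2" "\<forall>e \<in> set (row_degrees N2'). e = d2"
    using S by blast
  \<comment> \<open>\<open>mat_degree N1\<close> is the common row degree of \<open>N1\<close> only because \<open>N1\<close> has a row.\<close>
  have pos: "n > 0" "m > 0" using K1(1,2) K2(1,2) by (auto simp: minimal_basis_mat_def)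
  note N1 = is_dual_of_kernel[OF K1(1) assms(3)] and N2 = is_dual_of_kernel[OF K2(1) assms(4)]
  note shN1 = is_dual_of_shifts_degree[OF K1(1) pos(1) assms(3) N1']
  note shN2 = is_dual_of_shifts_degree[OF K2(1) pos(2) assms(4) N2']
  note shK1 = minimal_basis_mat_shifts_degree[OF K1(2,1,3)]
  note shK2 = minimal_basis_mat_shifts_degree[OF K2(2,1,3)]
  have "right_minimal_indices L (map (\<lambda>e. e + mat_degree N1) \<epsilon>)"
    if "right_minimal_indices Q \<epsilon>" for \<epsilon>
    using right_minimal_indices_block_matrix[OF M K1(1) K2(1) N1(1) N2(1) N1(2) N2(3) shN1 shK2] that
    unfolding assms(2,5) by simp
  moreover have "left_minimal_indices L (map (\<lambda>e. e + mat_degree N2) \<eta>)"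
    if \<eta>: "left_minimal_indices Q \<eta>" for \<eta>
  proof -
    have Mt: "M\<^sup>T \<in> carrier_mat (n + m1) (m + m2)" "has_grade M\<^sup>T l"
      using M has_grade_transpose by auto
    have "L\<^sup>T = block_matrix M\<^sup>T K2 K1"
      unfolding assms(2) block_matrix_def using M K1 K2
      by (subst transpose_four_block_mat[of _ "m + m2" "n + m1" _ m2 _ m1]) auto
    moreover have "Q\<^sup>T = N1 * M\<^sup>T * N2\<^sup>T"
    proof -
      have N1t: "N1\<^sup>T \<in> carrier_mat (n + m1) n" and N2t: "N2\<^sup>T \<in> carrier_mat (m + m2) m"
        using N1(1) N2(1) by simp_all
      have "Q\<^sup>T = N1 * (N2 * M)\<^sup>T"
        unfolding assms(5) using transpose_mult[OF mult_carrier_mat[OF N2(1) M(1)] N1t] by simp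
      also have "(N2 * M)\<^sup>T = M\<^sup>T * N2\<^sup>T" by (rule transpose_mult[OF N2(1) M(1)])
      also have "N1 * (M\<^sup>T * N2\<^sup>T) = N1 * M\<^sup>T * N2\<^sup>T"
        by (rule assoc_mult_mat[OF N1(1) Mt(1) N2t, symmetric])
      finally show ?thesis .
    qed
    ultimately show ?thesis
      using right_minimal_indices_block_matrix[OF Mt K2(1) K1(1) N2(1) N1(1) N2(2) N1(3) shN2 shK1] \<eta>
      unfolding left_minimal_indices_transpose by simp
  qed
  ultimately show ?thesis by blast
qed

end
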